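(* Let $c\in\mathbb{R}$, $T\in(0,+\infty]$ and let $\bar u_0:(0,+\infty)\to\mathbb{R}$ be globally Lipschitz continuous. Let $\bar u$ be a (viscosity) sub-solution and $\bar v$ a (viscosity) super-solution on $[0,T)\times(0,+\infty)$ of $$ r\,\bar u_t = c\sqrt{1+r^2\bar u_r^2}+\bar u_r\left(\frac{2+r^2\bar u_r^2}{1+r^2\bar u_r^2}\right)+\frac{r\,\bar u_{rr}}{1+r^2\bar u_r^2},\qquad \bar u(0,r)=\bar u_0(r). $$ Assume that there exists $C_1>0$ such that for all $t\in[0,T)$ and $r>0$, $$\bar u(t,r)-\bar u_0(r)\le C_1\quad\text{and}\quad \bar v(t,r)-\bar u_0(r)\ge -C_1 .$$ If $\bar u(0,r)\le \bar u_0(r)\le \bar v(0,r)$ for all $r>0$, then $\bar u\le\bar v$ in $[0,T)\times(0,+\infty)$.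
   Context: Set $\bar F(r,q,Y)=c\sqrt{1+r^2q^2}+q\left(\frac{2+r^2q^2}{1+r^2q^2}\right)+\frac{rY}{1+r^2q^2}$, so the equation reads $r\bar u_t=\bar F(r,\bar u_r,\bar u_{rr})$. A lower semi-continuous (resp. upper semi-continuous) function $u:[0,T)\times(0,+\infty)\to\mathbb{R}$ is a (viscosity) super-solution (resp. sub-solution) of the initial value problem on $[0,T)\times(0,+\infty)$ if for any $C^2$ test function $\phi$ such that $u-\phi$ reaches a local minimum (resp. maximum) at $(t,r)\in[0,T)\times(0,+\infty)$, one has: (i) if $t>0$, $r\phi_t\ge\bar F(r,\phi_r,\phi_{rr})$ (resp. $r\phi_t\le\bar F(r,\phi_r,\phi_{rr})$) at $(t,r)$; (ii) if $t=0$, $u(0,r)\ge\bar u_0(r)$ (resp. $u(0,r)\le\bar u_0(r)$). No condition is imposed at $r=0$. *)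

theory Defs
  imports "HOL-Analysis.Analysis"
begin

definition lsc_on :: "'a::topological_space set \<Rightarrow> ('a \<Rightarrow> real) \<Rightarrow> bool" where
  "lsc_on S u \<longleftrightarrow> (\<forall>x\<in>S. \<forall>a<u x. \<forall>\<^sub>F y in at x within S. a < u y)"

definition usc_on :: "'a::topological_space set \<Rightarrow> ('a \<Rightarrow> real) \<Rightarrow> bool" where
  "usc_on S u \<longleftrightarrow> (\<forall>x\<in>S. \<forall>a>u x. \<forall>\<^sub>F y in at x within S. u y < a)"

definition local_min_on :: "'a::topological_space set \<Rightarrow> ('a \<Rightarrow> real) \<Rightarrow> 'a \<Rightarrow> bool" where
  "local_min_on S f x \<longleftrightarrow> x \<in> S \<and> (\<forall>\<^sub>F y in at x within S. f x \<le> f y)"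

definition local_max_on :: "'a::topological_space set \<Rightarrow> ('a \<Rightarrow> real) \<Rightarrow> 'a \<Rightarrow> bool" where
  "local_max_on S f x \<longleftrightarrow> x \<in> S \<and> (\<forall>\<^sub>F y in at x within S. f y \<le> f x)"

text \<open>Derivatives are taken within \<open>S\<close>, so at boundary points belonging to \<open>S\<close> they are
  one-sided; the intended sets are convex with nonempty interior, where they are unique.\<close>

definition C1_on :: "'a::real_normed_vector set \<Rightarrow> ('a \<Rightarrow> 'b::real_normed_vector) \<Rightarrow> bool" where
  "C1_on S f \<longleftrightarrow> (\<exists>f' :: 'a \<Rightarrow> 'a \<Rightarrow>\<^sub>L 'b.
     (\<forall>x\<in>S. (f has_derivative blinfun_apply (f' x)) (at x within S)) \<and> continuous_on S f')"

definition C2_on :: "'a::real_normed_vector set \<Rightarrow> ('a \<Rightarrow> 'b::real_normed_vector) \<Rightarrow> bool" where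
  "C2_on S f \<longleftrightarrow> (\<exists>f' :: 'a \<Rightarrow> 'a \<Rightarrow>\<^sub>L 'b.
     (\<forall>x\<in>S. (f has_derivative blinfun_apply (f' x)) (at x within S)) \<and> C1_on S f')"

text \<open>The set \<open>[0,T) \<times> (0,\<infinity>)\<close> of points \<open>(t, r)\<close>, where \<open>T = \<infinity>\<close> is allowed.\<close>

definition spacetime :: "ereal \<Rightarrow> (real \<times> real) set" where
  "spacetime T = {(t, r). 0 \<le> t \<and> ereal t < T \<and> 0 < r}"

definition Fbar :: "real \<Rightarrow> real \<Rightarrow> real \<Rightarrow> real \<Rightarrow> real" where
  "Fbar c r q Y = c * sqrt (1 + r\<^sup>2 * q\<^sup>2) + q * ((2 + r\<^sup>2 * q\<^sup>2) / (1 + r\<^sup>2 * q\<^sup>2))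
     + r * Y / (1 + r\<^sup>2 * q\<^sup>2)"

definition d_t :: "(real \<times> real \<Rightarrow> real) \<Rightarrow> real \<Rightarrow> real \<Rightarrow> real" where
  "d_t \<phi> t r = deriv (\<lambda>s. \<phi> (s, r)) t"

definition d_r :: "(real \<times> real \<Rightarrow> real) \<Rightarrow> real \<Rightarrow> real \<Rightarrow> real" where
  "d_r \<phi> t r = deriv (\<lambda>x. \<phi> (t, x)) r"

definition d_rr :: "(real \<times> real \<Rightarrow> real) \<Rightarrow> real \<Rightarrow> real \<Rightarrow> real" where
  "d_rr \<phi> t r = deriv (\<lambda>x. d_r \<phi> t x) r"

text \<open>For test functions that are \<open>C\<^sup>2\<close> on \<open>spacetime T\<close>, the two-sided derivatives \<open>d_t\<close>, \<open>d_r\<close>, \<open>d_rr\<close>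
  are used below only at points with \<open>t > 0\<close>, which are interior to \<open>spacetime T\<close>.\<close>

definition viscosity_supersolution ::
  "real \<Rightarrow> ereal \<Rightarrow> (real \<Rightarrow> real) \<Rightarrow> (real \<times> real \<Rightarrow> real) \<Rightarrow> bool" where
  "viscosity_supersolution c T u0 u \<longleftrightarrow> lsc_on (spacetime T) u \<and>
     (\<forall>\<phi> t r. C2_on (spacetime T) \<phi> \<longrightarrow> local_min_on (spacetime T) (\<lambda>z. u z - \<phi> z) (t, r) \<longrightarrow>
        (t > 0 \<longrightarrow> r * d_t \<phi> t r \<ge> Fbar c r (d_r \<phi> t r) (d_rr \<phi> t r)) \<and>
        (t = 0 \<longrightarrow> u (0, r) \<ge> u0 r))"

definition viscosity_subsolution ::
  "real \<Rightarrow> ereal \<Rightarrow> (real \<Rightarrow> real) \<Rightarrow> (real \<times> real \<Rightarrow> real) \<Rightarrow> bool" where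
  "viscosity_subsolution c T u0 u \<longleftrightarrow> usc_on (spacetime T) u \<and>
     (\<forall>\<phi> t r. C2_on (spacetime T) \<phi> \<longrightarrow> local_max_on (spacetime T) (\<lambda>z. u z - \<phi> z) (t, r) \<longrightarrow>
        (t > 0 \<longrightarrow> r * d_t \<phi> t r \<le> Fbar c r (d_r \<phi> t r) (d_rr \<phi> t r)) \<and>
        (t = 0 \<longrightarrow> u (0, r) \<le> u0 r))"

end

theory Submission
  imports Defs
begin

text \<open>Variables are doubled: \<open>u(t,r) - v(s,\<rho>) - (r-\<rho>)\<^sup>2/(2\<epsilon>) - N(t-s)\<^sup>2 - \<alpha>(\<chi>(r) + \<chi>(\<rho>)) - \<dots>\<close> is maximized,
  where \<open>\<chi>(r) = ln (1 + r\<^sup>2) - ln r\<close> and \<open>\<alpha> = (4c\<^sup>2 + 1) \<epsilon>\<close>. For these choices the singular terms at \<open>r = 0\<close>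
  all have a good sign or are absorbed: the term \<open>q/r\<close> of the equation yields \<open>-(r-\<rho>)\<^sup>2/(\<epsilon>r\<rho>)\<close>, which dominates
  the variation of the diffusion coefficient, and \<open>-\<alpha> ln r\<close> yields \<open>-\<alpha>/r\<^sup>2\<close>, which dominates the forcing \<open>c/r\<close>.
  What remains is \<open>O(\<epsilon>)\<close>, against a fixed gain from a term linear in \<open>t\<close>.

  In one space dimension the matrix inequality at the maximum needs neither Alexandrov's theorem nor Jensen's
  lemma. Near the maximum point the equation is a lower bound \<open>X \<ge> b\<close> with constant \<open>b\<close> on the second derivatives
  of test functions, and this makes partial sup-convolutions along any line \<open>s \<mapsto> (a\<^sub>1 s, a\<^sub>2 s)\<close> satisfy a second
  difference inequality, which is compared with the quadratic upper bound of the doubled function.\<close>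

section \<open>Upper semicontinuous functions on compact sets\<close>

text \<open>The equation is divided by r and governed by p = r q. The logarithmic penalty fits this
  scaling: r \<chi>'(r) = 2 r^2 / (1 + r^2) - 1 lies in [-1, 1], so p changes by at most \<alpha> at
  every radius. Since \<chi> tends to infinity at 0 and at infinity, it also confines the maximum
  radially without a condition at r = 0. The matrix inequality is tested in a single direction, (s1,
  s2), made of the square roots 1 / sqrt (1 + p^2) of the two diffusion coefficients; there the
  doubling term contributes just (s1 - s2)^2 / \<epsilon>. The obstacle is that \<alpha> is tied to
  \<epsilon>, so the radial window grows as \<epsilon> shrinks and no compactness is uniform in
  \<epsilon>. Hence no limit in \<epsilon> is taken: the O(\<epsilon>) error has an explicit
  constant depending only on c, one small \<epsilon> is fixed, and all later parameters may depend
  on it.\<close>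

lemma usc_onD:
  assumes "usc_on S f" "x \<in> S" "f x < a"
  shows "\<exists>U. open U \<and> x \<in> U \<and> (\<forall>y\<in>U. y \<in> S \<longrightarrow> f y < a)"
proof -
  have "\<forall>\<^sub>F y in at x within S. f y < a"
    using assms unfolding usc_on_def by blast
  then obtain U where "open U" "x \<in> U" "\<forall>y\<in>U. y \<noteq> x \<longrightarrow> y \<in> S \<longrightarrow> f y < a"
    unfolding eventually_at_topological by blast
  with assms(3) show ?thesis
    by (intro exI[of _ U]) auto
qed

lemma usc_onI:
  assumes "\<And>x a. x \<in> S \<Longrightarrow> f x < a \<Longrightarrow> \<exists>U. open U \<and> x \<in> U \<and> (\<forall>y\<in>U. y \<in> S \<longrightarrow> f y < a)"
  shows "usc_on S f"
  unfolding usc_on_def eventually_at_topological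
proof (intro ballI allI impI)
  fix x a assume "x \<in> S" "f x < a"
  from assms[OF this] show "\<exists>U. open U \<and> x \<in> U \<and> (\<forall>y\<in>U. y \<noteq> x \<longrightarrow> y \<in> S \<longrightarrow> f y < a)"
    by blast
qed

lemma usc_on_subset:
  assumes "usc_on S f" "K \<subseteq> S"
  shows "usc_on K f"
proof (rule usc_onI)
  fix x a assume x: "x \<in> K" "f x < a"
  then have "x \<in> S" using assms(2) by blast
  from usc_onD[OF assms(1) this x(2)] show "\<exists>U. open U \<and> x \<in> U \<and> (\<forall>y\<in>U. y \<in> K \<longrightarrow> f y < a)"
    using assms(2) by blast
qed

lemma usc_on_compose:
  assumes "usc_on S f" "continuous_on K g" "g ` K \<subseteq> S"
  shows "usc_on K (\<lambda>x. f (g x))"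
proof (rule usc_onI)
  fix x a assume x: "x \<in> K" "f (g x) < a"
  then have "g x \<in> S" using assms(3) by blast
  from usc_onD[OF assms(1) this x(2)]
  obtain U where U: "open U" "g x \<in> U" "\<And>y. y \<in> U \<Longrightarrow> y \<in> S \<Longrightarrow> f y < a"
    by blast
  obtain V where "open V" "x \<in> V" "\<And>y. y \<in> K \<inter> V \<Longrightarrow> g y \<in> U"
    using assms(2) U(1,2) x(1) unfolding continuous_on_topological by (metis IntD1 IntD2)
  then show "\<exists>V. open V \<and> x \<in> V \<and> (\<forall>y\<in>V. y \<in> K \<longrightarrow> f (g y) < a)"
    using U(3) assms(3) by blast
qed

lemma usc_on_add:
  assumes "usc_on S f" "usc_on S g"
  shows "usc_on S (\<lambda>x. f x + g x)"
proof (rule usc_onI)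
  fix x a assume x: "x \<in> S" "f x + g x < a"
  define e where "e = (a - f x - g x) / 2"
  have e: "e > 0" using x by (simp add: e_def)
  obtain U where U: "open U" "x \<in> U" "\<And>y. y \<in> U \<Longrightarrow> y \<in> S \<Longrightarrow> f y < f x + e"
    using usc_onD[OF assms(1) x(1), of "f x + e"] e by auto
  obtain V where V: "open V" "x \<in> V" "\<And>y. y \<in> V \<Longrightarrow> y \<in> S \<Longrightarrow> g y < g x + e"
    using usc_onD[OF assms(2) x(1), of "g x + e"] e by auto
  have "f y + g y < a" if "y \<in> U \<inter> V" "y \<in> S" for y
  proof -
    have "f y < f x + e" "g y < g x + e" using that U V by auto
    then show ?thesis by (simp add: e_def field_simps)
  qed
  with U V show "\<exists>U. open U \<and> x \<in> U \<and> (\<forall>y\<in>U. y \<in> S \<longrightarrow> f y + g y < a)"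
    by (intro exI[of _ "U \<inter> V"]) auto
qed

lemma continuous_imp_usc_on:
  fixes f :: "'a::topological_space \<Rightarrow> real"
  assumes "continuous_on S f"
  shows "usc_on S f"
  unfolding usc_on_def
proof (intro ballI allI impI)
  fix x a assume "x \<in> S" "f x < a"
  then show "\<forall>\<^sub>F y in at x within S. f y < a"
    using assms order_tendstoD(2) unfolding continuous_on_def by blast
qed

lemma usc_on_diff_continuous:
  fixes f g :: "'a::topological_space \<Rightarrow> real"
  assumes f: "usc_on S f" and g: "continuous_on S g"
  shows "usc_on S (\<lambda>x. f x - g x)"
proof -
  have "usc_on S (\<lambda>x. - g x)"
    using g by (intro continuous_imp_usc_on continuous_on_minus)
  from usc_on_add[OF f this] show ?thesis by simp
qed

lemma lsc_on_uminus: "lsc_on S v \<Longrightarrow> usc_on S (\<lambda>z. - v z)"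
  unfolding usc_on_def
proof (intro ballI allI impI)
  fix z a assume v: "lsc_on S v" and "z \<in> S" "- v z < a"
  then have "- a < v z" by simp
  then have "\<forall>\<^sub>F y in at z within S. - a < v y"
    using v \<open>z \<in> S\<close> unfolding lsc_on_def by blast
  then show "\<forall>\<^sub>F y in at z within S. - v y < a"
    by eventually_elim simp
qed

text \<open>If no point were maximal, every x would have an \<open>m x\<close> of larger value, and
  the open sets where f stays below \<open>f (m x)\<close> would cover K. In a finite subcover the
  \<open>m x\<close> of largest value lies in none of these sets.\<close>

lemma usc_on_attains_max:
  assumes "compact K" "K \<noteq> {}" "usc_on K f"
  shows "\<exists>x\<in>K. \<forall>y\<in>K. f y \<le> f x"
proof (rule ccontr)
  assume "\<not> ?thesis"
  then have "\<forall>x\<in>K. \<exists>y. y \<in> K \<and> f x < f y"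
    by (auto simp: not_le)
  from bchoice[OF this] obtain m where m: "\<forall>x\<in>K. m x \<in> K \<and> f x < f (m x)"
    by blast
  have "\<exists>U. open U \<and> x \<in> U \<and> (\<forall>y\<in>U. y \<in> K \<longrightarrow> f y < f (m x))" if "x \<in> K" for x
  proof -
    have "f x < f (m x)" using m that by blast
    from usc_onD[OF assms(3) that this] show ?thesis .
  qed
  then have "\<forall>x\<in>K. \<exists>U. open U \<and> x \<in> U \<and> (\<forall>y\<in>U. y \<in> K \<longrightarrow> f y < f (m x))"
    by blast
  from bchoice[OF this] obtain U where U: "\<forall>x\<in>K. open (U x) \<and> x \<in> U x \<and> (\<forall>y\<in>U x. y \<in> K \<longrightarrow> f y < f (m x))"
    by blast
  have cover: "\<And>x. x \<in> K \<Longrightarrow> open (U x)" "K \<subseteq> (\<Union>x\<in>K. U x)"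
    using U by blast+
  obtain D where D: "D \<subseteq> K" "finite D" "K \<subseteq> (\<Union>x\<in>D. U x)"
    using compactE_image[OF assms(1) cover] by blast
  define V where "V = (\<lambda>y. f (m y)) ` D"
  have V: "finite V" "V \<noteq> {}"
    using D assms(2) by (auto simp: V_def)
  then have "Max V \<in> V" by (rule Max_in)
  then obtain x where x: "x \<in> D" "Max V = f (m x)" unfolding V_def by (rule imageE)
  have mK: "m x \<in> K" using x(1) D(1) m by blast
  then obtain y where y: "y \<in> D" "m x \<in> U y" using D(3) by blast
  then have "f (m x) < f (m y)" using U D(1) mK by blast
  moreover have "f (m y) \<le> Max V" using V(1) y(1) by (intro Max_ge) (auto simp: V_def)
  ultimately show False using x(2) by simp
qed

text \<open>This replaces the usual limit of maximizers as N tends to infinity. A suitable N exists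
  at each point and keeps working nearby by semicontinuity; since g is nonnegative, the sum over a
  finite subcover works everywhere.\<close>

lemma usc_on_penalization:
  fixes F :: "'a::topological_space \<Rightarrow> real"
  assumes K: "compact K" and usc: "usc_on K F" and cont: "continuous_on K g"
    and g: "\<And>z. z \<in> K \<Longrightarrow> 0 \<le> g z"
    and F: "\<And>z. z \<in> K \<Longrightarrow> g z = 0 \<Longrightarrow> F z < b"
  shows "\<exists>N\<ge>0. \<forall>z\<in>K. F z - N * g z < b"
proof -
  have "\<exists>N. 0 \<le> N \<and> F x - N * g x < b" if "x \<in> K" for x
  proof (cases "g x = 0")
    case True
    then show ?thesis using F[OF that] by auto
  next
    case False
    then show ?thesis using g[OF that]
      by (intro exI[of _ "(\<bar>F x - b\<bar> + 1) / g x"]) auto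
  qed
  then have "\<forall>x\<in>K. \<exists>N. 0 \<le> N \<and> F x - N * g x < b" by blast
  from bchoice[OF this] obtain N where N: "\<forall>x\<in>K. 0 \<le> N x \<and> F x - N x * g x < b"
    by blast
  have "\<exists>U. open U \<and> x \<in> U \<and> (\<forall>y\<in>U. y \<in> K \<longrightarrow> F y - N x * g y < b)" if x: "x \<in> K" for x
  proof -
    have "usc_on K (\<lambda>y. F y - N x * g y)"
      using usc cont by (intro usc_on_diff_continuous continuous_intros)
    from usc_onD[OF this x] show ?thesis using N x by blast
  qed
  then have "\<forall>x\<in>K. \<exists>U. open U \<and> x \<in> U \<and> (\<forall>y\<in>U. y \<in> K \<longrightarrow> F y - N x * g y < b)"
    by blast
  from bchoice[OF this] obtain U where U: "\<forall>x\<in>K. open (U x) \<and> x \<in> U x \<and> (\<forall>y\<in>U x. y \<in> K \<longrightarrow> F y - N x * g y < b)"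
    by blast
  have cover: "\<And>x. x \<in> K \<Longrightarrow> open (U x)" "K \<subseteq> (\<Union>x\<in>K. U x)"
    using U by blast+
  obtain D where D: "D \<subseteq> K" "finite D" "K \<subseteq> (\<Union>x\<in>D. U x)"
    using compactE_image[OF K cover] by blast
  define M where "M = (\<Sum>x\<in>D. N x)"
  have "F z - M * g z < b" if z: "z \<in> K" for z
  proof -
    obtain x where x: "x \<in> D" "z \<in> U x" using D(3) z by blast
    have "N x \<le> M"
      unfolding M_def using D N x(1) by (intro member_le_sum) auto
    then have "N x * g z \<le> M * g z" using g[OF z] by (rule mult_right_mono)
    moreover have "F z - N x * g z < b" using U D(1) x z by blast
    ultimately show ?thesis by simp
  qed
  moreover have "M \<ge> 0" unfolding M_def using N D(1) by (intro sum_nonneg) auto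
  ultimately show ?thesis by blast
qed

section \<open>Theorem on sums in one space dimension\<close>

text \<open>Only quadratic test functions are considered. The equation is of first order in time, so
  the time curvature N is left free, while the space curvature X is recorded. No mixed term is ever
  required.\<close>

definition touches_above ::
    "(real \<times> real \<Rightarrow> real) \<Rightarrow> real \<Rightarrow> real \<Rightarrow> real \<Rightarrow> real \<Rightarrow> real \<Rightarrow> bool" where
  "touches_above w t x \<alpha> p X \<longleftrightarrow> (\<exists>N. \<exists>e>0. \<forall>t' x'. \<bar>t' - t\<bar> < e \<longrightarrow> \<bar>x' - x\<bar> < e \<longrightarrow>
     w (t', x') \<le> w (t, x) + \<alpha> * (t' - t) + N * (t' - t)\<^sup>2 + p * (x' - x) + X / 2 * (x' - x)\<^sup>2)"

section \<open>Partial sup-convolutions along a line\<close>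

lemma sup_convolution_max:
  fixes w :: "real \<times> real \<Rightarrow> real"
  assumes usc: "usc_on ({-\<rho>..\<rho>} \<times> {-\<rho>..\<rho>}) w" and rho: "\<rho> > 0" and z: "\<bar>z\<bar> \<le> \<rho> / 2"
  obtains t y where "\<bar>t\<bar> \<le> \<rho> / 2" "\<bar>y\<bar> \<le> \<rho> / 2"
    "\<And>t' y'. \<bar>t'\<bar> \<le> \<rho> / 2 \<Longrightarrow> \<bar>y'\<bar> \<le> \<rho> / 2 \<Longrightarrow>
       w (t', z + y') - M * (t'\<^sup>2 + y'\<^sup>2) \<le> w (t, z + y) - M * (t\<^sup>2 + y\<^sup>2)"
proof -
  define B where "B = {-(\<rho>/2)..\<rho>/2} \<times> {-(\<rho>/2)..\<rho>/2}"
  have B: "compact B" "B \<noteq> {}" using rho by (auto simp: B_def intro!: compact_Times)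
  have "usc_on B (\<lambda>q. w (fst q, z + snd q))"
    by (rule usc_on_compose[OF usc])
       (use z in \<open>auto simp: B_def intro!: continuous_intros\<close>)
  then have "usc_on B (\<lambda>q. w (fst q, z + snd q) - M * ((fst q)\<^sup>2 + (snd q)\<^sup>2))"
    by (intro usc_on_diff_continuous continuous_intros)
  from usc_on_attains_max[OF B this] obtain q where q: "q \<in> B"
    "\<forall>q'\<in>B. w (fst q', z + snd q') - M * ((fst q')\<^sup>2 + (snd q')\<^sup>2)
          \<le> w (fst q, z + snd q) - M * ((fst q)\<^sup>2 + (snd q)\<^sup>2)" by blast
  show thesis
  proof (rule that[of "fst q" "snd q"])
    show "\<bar>fst q\<bar> \<le> \<rho>/2" "\<bar>snd q\<bar> \<le> \<rho>/2" using q(1) by (auto simp: B_def)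
    fix t' y' assume "\<bar>t'\<bar> \<le> \<rho> / 2" "\<bar>y'\<bar> \<le> \<rho> / 2"
    then have "(t', y') \<in> B" by (auto simp: B_def)
    with q(2) show "w (t', z + y') - M * (t'\<^sup>2 + y'\<^sup>2) \<le> w (fst q, z + snd q) - M * ((fst q)\<^sup>2 + (snd q)\<^sup>2)"
      by fastforce
  qed
qed

text \<open>By (z + y)^2 <= 2 z^2 + 2 y^2, the choice M >= 2 C + 1 absorbs the growth of w and still
  leaves -(t^2 + y^2). This surplus later forces the maximizing displacements to be of order
  |z|.\<close>

lemma sup_convolution_bound:
  fixes w0 wx C M t y z :: real
  assumes "wx \<le> w0 + C * (t\<^sup>2 + (z + y)\<^sup>2)" "0 \<le> C" "2 * C + 1 \<le> M"
  shows "wx - M * (t\<^sup>2 + y\<^sup>2) \<le> w0 + M * z\<^sup>2 - (t\<^sup>2 + y\<^sup>2)"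
proof -
  have "0 \<le> (z - y)\<^sup>2" by simp
  then have "(z + y)\<^sup>2 \<le> 2 * z\<^sup>2 + 2 * y\<^sup>2" by (simp add: power2_eq_square algebra_simps)
  then have "C * (t\<^sup>2 + (z + y)\<^sup>2) \<le> C * (t\<^sup>2 + (2 * z\<^sup>2 + 2 * y\<^sup>2))"
    using assms(2) by (intro mult_left_mono) auto
  also have "\<dots> \<le> C * (2 * t\<^sup>2 + (2 * z\<^sup>2 + 2 * y\<^sup>2))"
    using assms(2) by (intro mult_left_mono) auto
  also have "\<dots> = 2 * C * (t\<^sup>2 + y\<^sup>2) + 2 * C * z\<^sup>2" by (simp add: algebra_simps)
  also have "\<dots> \<le> (M - 1) * (t\<^sup>2 + y\<^sup>2) + M * z\<^sup>2"
    using assms(2,3) by (intro add_mono mult_right_mono) auto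
  finally show ?thesis using assms(1) by (simp add: algebra_simps)
qed

text \<open>If the second difference of the partial sup-convolution
  \<open>s \<mapsto> max\<^bsub>t,y\<^esub> (w (t, a s + y) - M (t\<^sup>2 + y\<^sup>2))\<close> were too small, a parabola of curvature below
  \<open>a\<^sup>2 b\<close> lying above it at \<open>\<plusminus>s\<close> would touch it from above strictly inside \<open>(-s, s)\<close>.\<close>

lemma sup_convolution_second_difference:
  fixes w :: "real \<times> real \<Rightarrow> real"
  assumes usc: "usc_on ({-\<rho>..\<rho>} \<times> {-\<rho>..\<rho>}) w" and rho: "\<rho> > 0"
    and C: "0 \<le> C" "2 * C + 1 \<le> M"
    and growth: "\<And>t x. \<bar>t\<bar> \<le> \<rho> \<Longrightarrow> \<bar>x\<bar> \<le> \<rho> \<Longrightarrow> w (t, x) \<le> w (0, 0) + C * (t\<^sup>2 + x\<^sup>2)"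
    and \<delta>: "\<delta> > 0"
    and touch: "\<And>t x \<alpha> p X. \<bar>t\<bar> < \<delta> \<Longrightarrow> \<bar>x\<bar> < \<delta> \<Longrightarrow> \<bar>\<alpha>\<bar> < \<delta> \<Longrightarrow> \<bar>p\<bar> < \<delta> \<Longrightarrow>
      touches_above w t x \<alpha> p X \<Longrightarrow> b \<le> X"
  shows "\<exists>s0>0. \<forall>s. 0 < s \<and> s < s0 \<longrightarrow> (\<exists>t1 y1 t2 y2.
     \<bar>t1\<bar> \<le> \<rho> \<and> \<bar>a * s + y1\<bar> \<le> \<rho> \<and> \<bar>t2\<bar> \<le> \<rho> \<and> \<bar>a * - s + y2\<bar> \<le> \<rho> \<and>
     a\<^sup>2 * b * s\<^sup>2 \<le> (w (t1, a * s + y1) - M * (t1\<^sup>2 + y1\<^sup>2))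
                   + (w (t2, a * - s + y2) - M * (t2\<^sup>2 + y2\<^sup>2)) - 2 * w (0, 0))"
proof (cases "a = 0")
  case True
  then show ?thesis using rho
    by (intro exI[of _ 1]) (auto intro!: exI[of _ 0])
next
  case False
  define m where "m = min \<delta> (\<rho> / 2)"
  have m: "m > 0" "m \<le> \<delta>" "m \<le> \<rho> / 2" using \<delta> rho by (auto simp: m_def)
  have M: "M \<ge> 1" "M > 0" "M \<le> M\<^sup>2" using C by (auto simp: power2_eq_square)
  define A where "A = M * \<bar>a\<bar>"
  have A: "A > 0" "\<bar>a\<bar> \<le> A" using False M by (auto simp: A_def)
  have AM: "A \<le> M * A" using A M by simp
  define E where "E \<sigma> t y = w (t, a * \<sigma> + y) - M * (t\<^sup>2 + y\<^sup>2)" for \<sigma> t y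
  have "\<exists>t1 y1 t2 y2.
     \<bar>t1\<bar> \<le> \<rho> \<and> \<bar>a * s + y1\<bar> \<le> \<rho> \<and> \<bar>t2\<bar> \<le> \<rho> \<and> \<bar>a * - s + y2\<bar> \<le> \<rho> \<and>
     a\<^sup>2 * b * s\<^sup>2 \<le> E s t1 y1 + E (- s) t2 y2 - 2 * w (0, 0)"
    if s: "0 < s" "s < m / (10 * (M * A))" for s
  proof -
    \<comment> \<open>The factor 10 leaves room for everything bounded below: |t0| and |y0| by 3 A
      s, |x0| and |p| by 4 A s, and the time slope 2 M |t0| by 6 M A s.\<close>
    have sm: "10 * (M * A * s) < m"
      using s(2) A(1) M(2) by (simp add: pos_less_divide_eq field_simps)
    have As: "0 < A * s" "A * s \<le> M * A * s"
      using A(1) s(1) AM by auto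
    have as: "\<bar>a * \<sigma>\<bar> \<le> A * s" if "\<bar>\<sigma>\<bar> \<le> s" for \<sigma>
      using A that by (auto simp: abs_mult intro!: mult_mono)
    have as2: "\<bar>a * \<sigma>\<bar> \<le> \<rho> / 2" if "\<bar>\<sigma>\<bar> \<le> s" for \<sigma>
      using as[OF that] As sm m by linarith
    define R where "R = M * (a * s)\<^sup>2"
    have R: "R > 0" using M False s by (simp add: R_def)
    have ub: "E \<sigma> t y \<le> w (0,0) + R - (t\<^sup>2 + y\<^sup>2)"
      if "\<bar>\<sigma>\<bar> \<le> s" "\<bar>t\<bar> \<le> \<rho>/2" "\<bar>y\<bar> \<le> \<rho>/2" for \<sigma> t y
    proof -
      have "E \<sigma> t y \<le> w (0,0) + M * (a * \<sigma>)\<^sup>2 - (t\<^sup>2 + y\<^sup>2)"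
        unfolding E_def
      proof (rule sup_convolution_bound[OF _ C])
        show "w (t, a * \<sigma> + y) \<le> w (0, 0) + C * (t\<^sup>2 + (a * \<sigma> + y)\<^sup>2)"
          using as2[OF that(1)] that(2,3) rho by (intro growth) linarith+
      qed
      moreover have "(a * \<sigma>)\<^sup>2 \<le> (a * s)\<^sup>2"
        using that(1) s(1) by (simp add: power_mult_distrib mult_left_mono abs_le_square_iff[symmetric])
      then have "M * (a * \<sigma>)\<^sup>2 \<le> R"
        unfolding R_def using M by (intro mult_left_mono) auto
      ultimately show ?thesis by linarith
    qed
    \<comment> \<open>The displacement -a \<sigma> leads back to the origin; together with
      \<open>ub\<close> it bounds the increments of the sup-convolution at s and -s by R in absolute
      value.\<close>
    have lb: "w (0,0) - R = E \<sigma> 0 (- (a * \<sigma>))" if "\<sigma> = s \<or> \<sigma> = - s" for \<sigma>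
      using that by (auto simp: E_def R_def)
    obtain t1 y1 where 1: "\<bar>t1\<bar> \<le> \<rho>/2" "\<bar>y1\<bar> \<le> \<rho>/2"
      "\<And>t' y'. \<bar>t'\<bar> \<le> \<rho>/2 \<Longrightarrow> \<bar>y'\<bar> \<le> \<rho>/2 \<Longrightarrow> E s t' y' \<le> E s t1 y1"
      unfolding E_def using sup_convolution_max[OF usc rho as2[of s], where M = M] s by auto
    obtain t2 y2 where 2: "\<bar>t2\<bar> \<le> \<rho>/2" "\<bar>y2\<bar> \<le> \<rho>/2"
      "\<And>t' y'. \<bar>t'\<bar> \<le> \<rho>/2 \<Longrightarrow> \<bar>y'\<bar> \<le> \<rho>/2 \<Longrightarrow> E (- s) t' y' \<le> E (- s) t2 y2"
      unfolding E_def using sup_convolution_max[OF usc rho as2[of "-s"], where M = M] s by auto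
    define fp fm where "fp = E s t1 y1 - w (0,0)" and "fm = E (- s) t2 y2 - w (0,0)"
    have "fp \<le> R" "fm \<le> R"
      using ub[OF _ 1(1,2), of s] ub[OF _ 2(1,2), of "-s"] s(1)
        sum_power2_ge_zero[of t1 y1] sum_power2_ge_zero[of t2 y2]
      unfolding fp_def fm_def by linarith+
    moreover have "- R \<le> fp" "- R \<le> fm"
      using lb[of s] lb[of "-s"] 1(3)[of 0 "-(a * s)"] 2(3)[of 0 "-(a * - s)"] as2[of s] s rho
      unfolding fp_def fm_def by auto
    ultimately have f: "\<bar>fp\<bar> \<le> R" "\<bar>fm\<bar> \<le> R" by auto
    have concl: "a\<^sup>2 * b * s\<^sup>2 \<le> fp + fm"
    proof (rule ccontr)
      assume neg: "\<not> a\<^sup>2 * b * s\<^sup>2 \<le> fp + fm"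
      \<comment> \<open>Half of the missing amount lifts the parabola strictly above the
        sup-convolution at both ends and still keeps its curvature below a^2 b. The cap R preserves
        the size bounds.\<close>
      define \<mu> where "\<mu> = min R ((a\<^sup>2 * b * s\<^sup>2 - (fp + fm)) / 2)"
      have mu: "0 < \<mu>" "\<mu> \<le> R" "fp + fm + \<mu> < a\<^sup>2 * b * s\<^sup>2"
        using neg R by (auto simp: \<mu>_def min_def field_simps)
      \<comment> \<open>Interpolation: the parabola \<phi> vanishes at 0 and takes the values fp +
        \<mu>/2 at s and fm + \<mu>/2 at -s.\<close>
      define k l where "k = (fp + fm + \<mu>) / s\<^sup>2" and "l = (fp - fm) / (2 * s)"
      have ks: "k * s\<^sup>2 = fp + fm + \<mu>" and ls: "l * s = (fp - fm) / 2"
        using s by (auto simp: k_def l_def field_simps)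
      have kls: "\<bar>k * s\<^sup>2\<bar> \<le> 3 * R" "\<bar>l * s\<bar> \<le> R"
        unfolding ks ls using f mu by auto
      define \<phi> where "\<phi> \<sigma> = l * \<sigma> + k / 2 * \<sigma>\<^sup>2" for \<sigma>
      have phib: "\<bar>\<phi> \<sigma>\<bar> \<le> 5 / 2 * R" if "\<bar>\<sigma>\<bar> \<le> s" for \<sigma>
      proof -
        have "\<bar>l * \<sigma>\<bar> \<le> \<bar>l * s\<bar>" using that s by (auto simp: abs_mult intro!: mult_left_mono)
        moreover have "\<bar>k * \<sigma>\<^sup>2\<bar> \<le> \<bar>k * s\<^sup>2\<bar>"
          using that s by (auto simp: abs_mult abs_le_square_iff[symmetric] intro!: mult_left_mono)
        moreover have "\<phi> \<sigma> = l * \<sigma> + (k * \<sigma>\<^sup>2) / 2" by (simp add: \<phi>_def)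
        ultimately show ?thesis using kls by linarith
      qed
      define K where "K = {-s..s} \<times> {-(\<rho>/2)..\<rho>/2} \<times> {-(\<rho>/2)..\<rho>/2}"
      have K: "compact K" "K \<noteq> {}" using s rho by (auto simp: K_def intro!: compact_Times)
      have "usc_on K (\<lambda>q. w (fst (snd q), a * fst q + snd (snd q)))"
      proof (rule usc_on_compose[OF usc])
        show "continuous_on K (\<lambda>q. (fst (snd q), a * fst q + snd (snd q)))"
          by (intro continuous_intros)
        show "(\<lambda>q. (fst (snd q), a * fst q + snd (snd q))) ` K \<subseteq> {-\<rho>..\<rho>} \<times> {-\<rho>..\<rho>}"
        proof (rule image_subsetI)
          fix q assume q: "q \<in> K"
          then have "\<bar>a * fst q\<bar> \<le> \<rho> / 2" by (intro as2) (auto simp: K_def)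
          moreover have "\<bar>fst (snd q)\<bar> \<le> \<rho> / 2" "\<bar>snd (snd q)\<bar> \<le> \<rho> / 2"
            using q by (auto simp: K_def)
          ultimately have "\<bar>fst (snd q)\<bar> \<le> \<rho>" "\<bar>a * fst q + snd (snd q)\<bar> \<le> \<rho>"
            using rho by linarith+
          then show "(fst (snd q), a * fst q + snd (snd q)) \<in> {-\<rho>..\<rho>} \<times> {-\<rho>..\<rho>}"
            by auto
        qed
      qed
      then have "usc_on K (\<lambda>q. w (fst (snd q), a * fst q + snd (snd q)) -
          (M * ((fst (snd q))\<^sup>2 + (snd (snd q))\<^sup>2) + \<phi> (fst q)))"
        unfolding \<phi>_def by (rule usc_on_diff_continuous) (intro continuous_intros)
      from usc_on_attains_max[OF K this]
      obtain \<sigma>0 t0 y0 where q: "(\<sigma>0, t0, y0) \<in> K"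
        and qmax: "\<And>\<sigma> t y. (\<sigma>, t, y) \<in> K \<Longrightarrow> E \<sigma> t y - \<phi> \<sigma> \<le> E \<sigma>0 t0 y0 - \<phi> \<sigma>0"
        unfolding E_def by fastforce
      have q': "\<bar>\<sigma>0\<bar> \<le> s" "\<bar>t0\<bar> \<le> \<rho>/2" "\<bar>y0\<bar> \<le> \<rho>/2" using q by (auto simp: K_def)
      have "(0,0,0) \<in> K" using s rho by (auto simp: K_def)
      from qmax[OF this] have low: "w (0,0) \<le> E \<sigma>0 t0 y0 - \<phi> \<sigma>0"
        by (simp add: E_def \<phi>_def)
      \<comment> \<open>At the ends \<open>E - \<phi>\<close> is at most w (0,0) - \<mu>/2, below
        the value w (0,0) reached at \<sigma> = t = y = 0.\<close>
      have ne: "\<sigma>0 \<noteq> s" "\<sigma>0 \<noteq> - s"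
      proof -
        have "E s t0 y0 - \<phi> s < w (0,0)"
        proof -
          have "E s t0 y0 \<le> fp + w (0,0)" using 1(3)[OF q'(2,3)] by (simp add: fp_def)
          moreover have "\<phi> s = fp + \<mu> / 2" using ks ls by (simp add: \<phi>_def field_simps)
          ultimately show ?thesis using mu by simp
        qed
        then show "\<sigma>0 \<noteq> s" using low by auto
        have "E (-s) t0 y0 - \<phi> (-s) < w (0,0)"
        proof -
          have "E (-s) t0 y0 \<le> fm + w (0,0)" using 2(3)[OF q'(2,3)] by (simp add: fm_def)
          moreover have "\<phi> (-s) = fm + \<mu> / 2" using ks ls by (simp add: \<phi>_def field_simps)
          ultimately show ?thesis using mu by simp
        qed
        then show "\<sigma>0 \<noteq> - s" using low by auto
      qed
      have sig: "\<bar>\<sigma>0\<bar> < s" using q'(1) ne by auto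
      \<comment> \<open>The bounds give R + 5/2 R; the constant is rounded up to the perfect square
        9, so that M <= M^2 yields (3 A s)^2.\<close>
      have "t0\<^sup>2 + y0\<^sup>2 \<le> 9 * R"
        using low ub[OF q'] phib[OF q'(1)] R by linarith
      also have "\<dots> \<le> 9 * (M\<^sup>2 * (a * s)\<^sup>2)"
        unfolding R_def using M by (intro mult_left_mono mult_right_mono) auto
      also have "\<dots> = (3 * (A * s))\<^sup>2"
        by (simp add: A_def power2_eq_square algebra_simps)
      finally have ty2: "t0\<^sup>2 + y0\<^sup>2 \<le> (3 * (A * s))\<^sup>2" .
      have "t0\<^sup>2 \<le> (3 * (A * s))\<^sup>2" "y0\<^sup>2 \<le> (3 * (A * s))\<^sup>2"
        using ty2 zero_le_power2[of t0] zero_le_power2[of y0] by linarith+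
      then have ty: "\<bar>t0\<bar> \<le> 3 * (A * s)" "\<bar>y0\<bar> \<le> 3 * (A * s)"
        using As(1) unfolding abs_le_square_iff[symmetric] by auto
      \<comment> \<open>With the displacement frozen at y0, moving \<sigma> moves the argument x = a
        \<sigma> + y0 of w. The parabola in \<sigma> thus touches w in x, its slope divided by a and
        its curvature by a^2; the time slope 2 M t0 comes from the term M t^2.\<close>
      define x0 where "x0 = a * \<sigma>0 + y0"
      define p where "p = (l + k * \<sigma>0) / a"
      define X where "X = k / a\<^sup>2"
      have "touches_above w t0 x0 (2 * M * t0) p X"
        unfolding touches_above_def
      proof (rule exI[of _ M], rule exI[of _ "min (\<bar>a\<bar> * (s - \<bar>\<sigma>0\<bar>)) (\<rho>/2 - \<bar>t0\<bar>)"], intro conjI allI impI)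
        have "\<bar>t0\<bar> < \<rho> / 2" using ty As sm m by linarith
        then show "0 < min (\<bar>a\<bar> * (s - \<bar>\<sigma>0\<bar>)) (\<rho>/2 - \<bar>t0\<bar>)" using sig False by simp
        fix t x assume t: "\<bar>t - t0\<bar> < min (\<bar>a\<bar> * (s - \<bar>\<sigma>0\<bar>)) (\<rho>/2 - \<bar>t0\<bar>)"
          and x: "\<bar>x - x0\<bar> < min (\<bar>a\<bar> * (s - \<bar>\<sigma>0\<bar>)) (\<rho>/2 - \<bar>t0\<bar>)"
        define \<sigma> where "\<sigma> = (x - y0) / a"
        have xs: "x = a * \<sigma> + y0" using False by (simp add: \<sigma>_def)
        have xx: "x - x0 = a * (\<sigma> - \<sigma>0)" by (simp add: xs x0_def algebra_simps)
        have "\<bar>a\<bar> * \<bar>\<sigma> - \<sigma>0\<bar> < \<bar>a\<bar> * (s - \<bar>\<sigma>0\<bar>)"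
          using x unfolding xx abs_mult by simp
        then have "\<bar>\<sigma> - \<sigma>0\<bar> < s - \<bar>\<sigma>0\<bar>" using False by simp
        then have "\<bar>\<sigma>\<bar> \<le> s" by linarith
        moreover have "\<bar>t\<bar> \<le> \<rho> / 2" using t by linarith
        ultimately have "(\<sigma>, t, y0) \<in> K" using q'(3) by (auto simp: K_def)
        from qmax[OF this]
        have "w (t, x) \<le> w (t0, x0) + M * (t\<^sup>2 - t0\<^sup>2) + (\<phi> \<sigma> - \<phi> \<sigma>0)"
          unfolding E_def xs x0_def by (simp add: algebra_simps)
        moreover have "M * (t\<^sup>2 - t0\<^sup>2) = 2 * M * t0 * (t - t0) + M * (t - t0)\<^sup>2"
          by (simp add: power2_eq_square algebra_simps)
        moreover have "\<phi> \<sigma> - \<phi> \<sigma>0 = (l + k * \<sigma>0) * (\<sigma> - \<sigma>0) + k / 2 * (\<sigma> - \<sigma>0)\<^sup>2"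
          by (simp add: \<phi>_def power2_eq_square field_simps)
        moreover have "(l + k * \<sigma>0) * (\<sigma> - \<sigma>0) = p * (x - x0)"
          "k / 2 * (\<sigma> - \<sigma>0)\<^sup>2 = X / 2 * (x - x0)\<^sup>2"
          unfolding xx p_def X_def using False by (auto simp: power_mult_distrib)
        ultimately show "w (t, x) \<le> w (t0, x0) + 2 * M * t0 * (t - t0) + M * (t - t0)\<^sup>2
            + p * (x - x0) + X / 2 * (x - x0)\<^sup>2" by linarith
      qed
      moreover have "\<bar>t0\<bar> < \<delta>" using ty As sm m by linarith
      moreover have "\<bar>x0\<bar> < \<delta>"
        using ty As sm m as[OF q'(1)] unfolding x0_def by linarith
      moreover have "\<bar>2 * M * t0\<bar> < \<delta>"
      proof -
        have "\<bar>2 * M * t0\<bar> = 2 * (M * \<bar>t0\<bar>)" using M by (simp add: abs_mult)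
        also have "\<dots> \<le> 2 * (M * (3 * (A * s)))"
          using ty(1) M by (intro mult_left_mono) auto
        also have "\<dots> < \<delta>" using As sm m by (simp add: algebra_simps)
        finally show ?thesis .
      qed
      moreover have "\<bar>p\<bar> < \<delta>"
      proof -
        have "\<bar>l + k * \<sigma>0\<bar> * s \<le> \<bar>l * s\<bar> + \<bar>k * s\<^sup>2\<bar>"
        proof -
          have "\<bar>k * \<sigma>0\<bar> \<le> \<bar>k\<bar> * s" unfolding abs_mult using q'(1) by (intro mult_left_mono) auto
          then have "\<bar>l + k * \<sigma>0\<bar> \<le> \<bar>l\<bar> + \<bar>k\<bar> * s" by linarith
          then have "\<bar>l + k * \<sigma>0\<bar> * s \<le> (\<bar>l\<bar> + \<bar>k\<bar> * s) * s" using s by (intro mult_right_mono) auto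
          also have "\<dots> = \<bar>l * s\<bar> + \<bar>k * s\<^sup>2\<bar>" using s by (simp add: abs_mult power2_eq_square algebra_simps)
          finally show ?thesis .
        qed
        also have "\<dots> \<le> 4 * R" using kls by linarith
        also have "4 * R = (4 * (A * s) * \<bar>a\<bar>) * s"
          by (simp add: R_def A_def power2_eq_square algebra_simps)
        finally have "\<bar>l + k * \<sigma>0\<bar> \<le> 4 * (A * s) * \<bar>a\<bar>"
          using s(1) by (rule mult_right_le_imp_le)
        then have "\<bar>p\<bar> \<le> 4 * (A * s)" using False by (simp add: p_def abs_divide divide_le_eq)
        then show ?thesis using As sm m by linarith
      qed
      ultimately have "b \<le> X" using touch by blast
      moreover have "X < b"
      proof -
        have "k * s\<^sup>2 < a\<^sup>2 * b * s\<^sup>2" using ks mu by simp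
        then have "k < a\<^sup>2 * b" using s by simp
        then show ?thesis using False by (simp add: X_def divide_less_eq mult.commute)
      qed
      ultimately show False by simp
    qed
    show ?thesis
    proof (rule exI[of _ t1], rule exI[of _ y1], rule exI[of _ t2], rule exI[of _ y2], intro conjI)
      show "\<bar>t1\<bar> \<le> \<rho>" "\<bar>t2\<bar> \<le> \<rho>" using 1 2 rho by linarith+
      show "\<bar>a * s + y1\<bar> \<le> \<rho>" "\<bar>a * - s + y2\<bar> \<le> \<rho>"
        using 1(2) 2(2) as2[of s] as2[of "-s"] s by linarith+
      show "a\<^sup>2 * b * s\<^sup>2 \<le> E s t1 y1 + E (- s) t2 y2 - 2 * w (0, 0)"
        using concl by (simp add: fp_def fm_def)
    qed
  qed
  moreover have "0 < m / (10 * (M * A))" using m A M by simp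
  ultimately show ?thesis unfolding E_def by blast
qed

text \<open>Young's inequality with weight \<eta> on the terms linear in s. The shifts x and y will
  be sup-convolution displacements, so their coefficient may be as large as 1/\<eta>: M is chosen
  after \<eta>.\<close>

lemma quadratic_form_shift:
  fixes A B D a1 a2 s x y \<eta> :: real
  assumes "\<eta> > 0"
  shows "A * (a1 * s + x)\<^sup>2 + 2 * B * (a1 * s + x) * (a2 * s + y) + D * (a2 * s + y)\<^sup>2
    \<le> (A * a1\<^sup>2 + 2 * B * a1 * a2 + D * a2\<^sup>2 + \<eta>) * s\<^sup>2
      + 2 * (((A * a1 + B * a2)\<^sup>2 + (B * a1 + D * a2)\<^sup>2) / \<eta> + \<bar>A\<bar> + \<bar>B\<bar> + \<bar>D\<bar>) * (x\<^sup>2 + y\<^sup>2)"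
proof -
  define G H where "G = A * a1 + B * a2" and "H = B * a1 + D * a2"
  have "0 \<le> (\<eta> * s - (G * x + H * y))\<^sup>2" by simp
  then have "2 * s * (G * x + H * y) * \<eta> \<le> (\<eta> * s)\<^sup>2 + (G * x + H * y)\<^sup>2"
    by (simp add: power2_eq_square algebra_simps)
  also have "(G * x + H * y)\<^sup>2 \<le> (G\<^sup>2 + H\<^sup>2) * (x\<^sup>2 + y\<^sup>2)"
  proof -
    have "0 \<le> (G * y - H * x)\<^sup>2" by simp
    then show ?thesis by (simp add: power2_eq_square algebra_simps)
  qed
  finally have "2 * s * (G * x + H * y) \<le> ((\<eta> * s)\<^sup>2 + (G\<^sup>2 + H\<^sup>2) * (x\<^sup>2 + y\<^sup>2)) / \<eta>"
    using assms by (simp add: pos_le_divide_eq)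
  also have "\<dots> = \<eta> * s\<^sup>2 + (G\<^sup>2 + H\<^sup>2) / \<eta> * (x\<^sup>2 + y\<^sup>2)"
    using assms by (simp add: power2_eq_square field_simps)
  also have "\<dots> \<le> \<eta> * s\<^sup>2 + 2 * ((G\<^sup>2 + H\<^sup>2) / \<eta>) * (x\<^sup>2 + y\<^sup>2)"
  proof -
    have "(G\<^sup>2 + H\<^sup>2) / \<eta> \<ge> 0" using assms by simp
    then have "(G\<^sup>2 + H\<^sup>2) / \<eta> \<le> 2 * ((G\<^sup>2 + H\<^sup>2) / \<eta>)" by linarith
    then show ?thesis by (intro add_left_mono mult_right_mono) auto
  qed
  finally have 1: "2 * s * (G * x + H * y) \<le> \<eta> * s\<^sup>2 + 2 * ((G\<^sup>2 + H\<^sup>2) / \<eta>) * (x\<^sup>2 + y\<^sup>2)" .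
  have "A * x\<^sup>2 \<le> \<bar>A\<bar> * (x\<^sup>2 + y\<^sup>2)" "D * y\<^sup>2 \<le> \<bar>D\<bar> * (x\<^sup>2 + y\<^sup>2)"
    by (auto intro!: mult_mono)
  moreover have "2 * B * x * y \<le> \<bar>B\<bar> * (x\<^sup>2 + y\<^sup>2)"
  proof -
    have "2 * B * x * y \<le> \<bar>B\<bar> * (2 * \<bar>x\<bar> * \<bar>y\<bar>)"
      using abs_ge_self[of "2 * B * x * y"] by (simp add: abs_mult algebra_simps)
    also have "\<dots> \<le> \<bar>B\<bar> * (x\<^sup>2 + y\<^sup>2)"
    proof (rule mult_left_mono)
      have "0 \<le> (\<bar>x\<bar> - \<bar>y\<bar>)\<^sup>2" by simp
      then show "2 * \<bar>x\<bar> * \<bar>y\<bar> \<le> x\<^sup>2 + y\<^sup>2" by (simp add: power2_diff)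
    qed simp
    finally show ?thesis .
  qed
  ultimately have "A * x\<^sup>2 + 2 * B * x * y + D * y\<^sup>2
      \<le> \<bar>A\<bar> * (x\<^sup>2 + y\<^sup>2) + \<bar>B\<bar> * (x\<^sup>2 + y\<^sup>2) + \<bar>D\<bar> * (x\<^sup>2 + y\<^sup>2)"
    by (intro add_mono)
  also have "\<dots> = (\<bar>A\<bar> + \<bar>B\<bar> + \<bar>D\<bar>) * (x\<^sup>2 + y\<^sup>2)" by (simp add: distrib_right)
  also have "\<dots> \<le> (2 * (\<bar>A\<bar> + \<bar>B\<bar> + \<bar>D\<bar>)) * (x\<^sup>2 + y\<^sup>2)"
    by (intro mult_right_mono) auto
  finally have 2: "A * x\<^sup>2 + 2 * B * x * y + D * y\<^sup>2 \<le> 2 * (\<bar>A\<bar> + \<bar>B\<bar> + \<bar>D\<bar>) * (x\<^sup>2 + y\<^sup>2)" .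
  have "A * (a1 * s + x)\<^sup>2 + 2 * B * (a1 * s + x) * (a2 * s + y) + D * (a2 * s + y)\<^sup>2
    = (A * a1\<^sup>2 + 2 * B * a1 * a2 + D * a2\<^sup>2) * s\<^sup>2 + 2 * s * (G * x + H * y)
      + (A * x\<^sup>2 + 2 * B * x * y + D * y\<^sup>2)"
    by (simp add: G_def H_def power2_eq_square algebra_simps)
  with 1 2 show ?thesis
    unfolding G_def[symmetric] H_def[symmetric] by (simp add: distrib_left distrib_right)
qed

text \<open>This is the Crandall-Ishii matrix inequality in one direction (a1, a2), with the lower
  bounds b1 and b2 in place of second derivatives. Both sup-convolutions are taken along the same
  parameter s: the sum of their second differences at s and -s is at least (a1^2 b1 + a2^2 b2) s^2,
  while \<open>quad\<close> bounds it by the form plus \<eta> times s^2.\<close>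

lemma theorem_on_sums:
  fixes w1 w2 :: "real \<times> real \<Rightarrow> real"
  assumes rho: "\<rho> > 0" and m: "m \<ge> 0" and \<delta>: "\<delta> > 0"
    and usc1: "usc_on ({-\<rho>..\<rho>} \<times> {-\<rho>..\<rho>}) w1"
    and usc2: "usc_on ({-\<rho>..\<rho>} \<times> {-\<rho>..\<rho>}) w2"
    and touch1: "\<And>t x \<alpha> p X. \<bar>t\<bar> < \<delta> \<Longrightarrow> \<bar>x\<bar> < \<delta> \<Longrightarrow> \<bar>\<alpha>\<bar> < \<delta> \<Longrightarrow> \<bar>p\<bar> < \<delta> \<Longrightarrow>
      touches_above w1 t x \<alpha> p X \<Longrightarrow> b1 \<le> X"
    and touch2: "\<And>t x \<alpha> p X. \<bar>t\<bar> < \<delta> \<Longrightarrow> \<bar>x\<bar> < \<delta> \<Longrightarrow> \<bar>\<alpha>\<bar> < \<delta> \<Longrightarrow> \<bar>p\<bar> < \<delta> \<Longrightarrow>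
      touches_above w2 t x \<alpha> p X \<Longrightarrow> b2 \<le> X"
    and quad: "\<And>t x s y. \<bar>t\<bar> \<le> \<rho> \<Longrightarrow> \<bar>x\<bar> \<le> \<rho> \<Longrightarrow> \<bar>s\<bar> \<le> \<rho> \<Longrightarrow> \<bar>y\<bar> \<le> \<rho> \<Longrightarrow>
      w1 (t, x) + w2 (s, y) \<le> w1 (0, 0) + w2 (0, 0) + m * (t\<^sup>2 + s\<^sup>2)
        + (A * x\<^sup>2 + 2 * B * x * y + D * y\<^sup>2) / 2"
  shows "a1\<^sup>2 * b1 + a2\<^sup>2 * b2 \<le> A * a1\<^sup>2 + 2 * B * a1 * a2 + D * a2\<^sup>2"
proof (rule field_le_epsilon)
  fix \<eta> :: real assume \<eta>: "\<eta> > 0"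
  define Q where "Q = A * a1\<^sup>2 + 2 * B * a1 * a2 + D * a2\<^sup>2"
  define C1 where "C1 = ((A * a1 + B * a2)\<^sup>2 + (B * a1 + D * a2)\<^sup>2) / \<eta> + \<bar>A\<bar> + \<bar>B\<bar> + \<bar>D\<bar>"
  define C where "C = m + \<bar>A\<bar> + \<bar>D\<bar>"
  \<comment> \<open>One M serves both functions: 2 C + 1 is for the sup-convolutions, C1 for the
    displacements left by \<open>quadratic_form_shift\<close>. It depends on \<eta>, which is
    harmless because s is picked afterwards.\<close>
  define M where "M = 2 * C + 1 + C1"
  have "C1 \<ge> 0" using \<eta> by (simp add: C1_def)
  then have C: "0 \<le> C" "2 * C + 1 \<le> M" "m \<le> M" "C1 \<le> M"
    using m by (auto simp: C_def M_def)
  have growth1: "w1 (t, x) \<le> w1 (0, 0) + C * (t\<^sup>2 + x\<^sup>2)" if "\<bar>t\<bar> \<le> \<rho>" "\<bar>x\<bar> \<le> \<rho>" for t x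
  proof -
    have "w1 (t, x) \<le> w1 (0, 0) + m * t\<^sup>2 + A / 2 * x\<^sup>2" using quad[OF that, of 0 0] rho by simp
    also have "\<dots> \<le> w1 (0, 0) + C * t\<^sup>2 + C * x\<^sup>2"
      using m by (intro add_mono mult_right_mono) (auto simp: C_def)
    finally show ?thesis by (simp add: distrib_left)
  qed
  have "\<exists>s0>0. \<forall>s. 0 < s \<and> s < s0 \<longrightarrow> (\<exists>t1 y1 t2 y2.
     \<bar>t1\<bar> \<le> \<rho> \<and> \<bar>a1 * s + y1\<bar> \<le> \<rho> \<and> \<bar>t2\<bar> \<le> \<rho> \<and> \<bar>a1 * - s + y2\<bar> \<le> \<rho> \<and>
     a1\<^sup>2 * b1 * s\<^sup>2 \<le> (w1 (t1, a1 * s + y1) - M * (t1\<^sup>2 + y1\<^sup>2))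
                   + (w1 (t2, a1 * - s + y2) - M * (t2\<^sup>2 + y2\<^sup>2)) - 2 * w1 (0, 0))"
    by (rule sup_convolution_second_difference[OF usc1 rho C(1,2) _ \<delta>])
       (rule growth1 touch1; assumption)+
  then obtain s1 where s1: "s1 > 0" "\<And>s. 0 < s \<Longrightarrow> s < s1 \<Longrightarrow> \<exists>t1 y1 t2 y2.
     \<bar>t1\<bar> \<le> \<rho> \<and> \<bar>a1 * s + y1\<bar> \<le> \<rho> \<and> \<bar>t2\<bar> \<le> \<rho> \<and> \<bar>a1 * - s + y2\<bar> \<le> \<rho> \<and>
     a1\<^sup>2 * b1 * s\<^sup>2 \<le> (w1 (t1, a1 * s + y1) - M * (t1\<^sup>2 + y1\<^sup>2))
                   + (w1 (t2, a1 * - s + y2) - M * (t2\<^sup>2 + y2\<^sup>2)) - 2 * w1 (0, 0)"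
    by blast
  have growth2: "w2 (t, x) \<le> w2 (0, 0) + C * (t\<^sup>2 + x\<^sup>2)" if "\<bar>t\<bar> \<le> \<rho>" "\<bar>x\<bar> \<le> \<rho>" for t x
  proof -
    have "w2 (t, x) \<le> w2 (0, 0) + m * t\<^sup>2 + D / 2 * x\<^sup>2" using quad[of 0 0, OF _ _ that] rho by simp
    also have "\<dots> \<le> w2 (0, 0) + C * t\<^sup>2 + C * x\<^sup>2"
      using m by (intro add_mono mult_right_mono) (auto simp: C_def)
    finally show ?thesis by (simp add: distrib_left)
  qed
  have "\<exists>s0>0. \<forall>s. 0 < s \<and> s < s0 \<longrightarrow> (\<exists>t1 y1 t2 y2.
     \<bar>t1\<bar> \<le> \<rho> \<and> \<bar>a2 * s + y1\<bar> \<le> \<rho> \<and> \<bar>t2\<bar> \<le> \<rho> \<and> \<bar>a2 * - s + y2\<bar> \<le> \<rho> \<and>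
     a2\<^sup>2 * b2 * s\<^sup>2 \<le> (w2 (t1, a2 * s + y1) - M * (t1\<^sup>2 + y1\<^sup>2))
                   + (w2 (t2, a2 * - s + y2) - M * (t2\<^sup>2 + y2\<^sup>2)) - 2 * w2 (0, 0))"
    by (rule sup_convolution_second_difference[OF usc2 rho C(1,2) _ \<delta>])
       (rule growth2 touch2; assumption)+
  then obtain s2 where s2: "s2 > 0" "\<And>s. 0 < s \<Longrightarrow> s < s2 \<Longrightarrow> \<exists>t1 y1 t2 y2.
     \<bar>t1\<bar> \<le> \<rho> \<and> \<bar>a2 * s + y1\<bar> \<le> \<rho> \<and> \<bar>t2\<bar> \<le> \<rho> \<and> \<bar>a2 * - s + y2\<bar> \<le> \<rho> \<and>
     a2\<^sup>2 * b2 * s\<^sup>2 \<le> (w2 (t1, a2 * s + y1) - M * (t1\<^sup>2 + y1\<^sup>2))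
                   + (w2 (t2, a2 * - s + y2) - M * (t2\<^sup>2 + y2\<^sup>2)) - 2 * w2 (0, 0)"
    by blast
  define s where "s = min s1 s2 / 2"
  have s: "0 < s" "s < s1" "s < s2" using s1(1) s2(1) by (auto simp: s_def)
  from s1(2)[OF s(1,2)] obtain t1 y1 t2 y2 where 1:
     "\<bar>t1\<bar> \<le> \<rho>" "\<bar>a1 * s + y1\<bar> \<le> \<rho>" "\<bar>t2\<bar> \<le> \<rho>" "\<bar>a1 * - s + y2\<bar> \<le> \<rho>"
     "a1\<^sup>2 * b1 * s\<^sup>2 \<le> (w1 (t1, a1 * s + y1) - M * (t1\<^sup>2 + y1\<^sup>2))
                   + (w1 (t2, a1 * - s + y2) - M * (t2\<^sup>2 + y2\<^sup>2)) - 2 * w1 (0, 0)" by blast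
  from s2(2)[OF s(1,3)] obtain t1' y1' t2' y2' where 2:
     "\<bar>t1'\<bar> \<le> \<rho>" "\<bar>a2 * s + y1'\<bar> \<le> \<rho>" "\<bar>t2'\<bar> \<le> \<rho>" "\<bar>a2 * - s + y2'\<bar> \<le> \<rho>"
     "a2\<^sup>2 * b2 * s\<^sup>2 \<le> (w2 (t1', a2 * s + y1') - M * (t1'\<^sup>2 + y1'\<^sup>2))
                   + (w2 (t2', a2 * - s + y2') - M * (t2'\<^sup>2 + y2'\<^sup>2)) - 2 * w2 (0, 0)" by blast
  have upper: "(w1 (t, a1 * \<sigma> + y) - M * (t\<^sup>2 + y\<^sup>2)) + (w2 (t', a2 * \<sigma> + y') - M * (t'\<^sup>2 + y'\<^sup>2))
      \<le> w1 (0,0) + w2 (0,0) + (Q + \<eta>) / 2 * \<sigma>\<^sup>2"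
    if "\<bar>t\<bar> \<le> \<rho>" "\<bar>a1 * \<sigma> + y\<bar> \<le> \<rho>" "\<bar>t'\<bar> \<le> \<rho>" "\<bar>a2 * \<sigma> + y'\<bar> \<le> \<rho>" for t y t' y' \<sigma>
  proof -
    have "m * (t\<^sup>2 + t'\<^sup>2) \<le> M * (t\<^sup>2 + t'\<^sup>2)" "C1 * (y\<^sup>2 + y'\<^sup>2) \<le> M * (y\<^sup>2 + y'\<^sup>2)"
      using C by (auto intro!: mult_right_mono)
    moreover define q where "q = A * (a1 * \<sigma> + y)\<^sup>2 + 2 * B * (a1 * \<sigma> + y) * (a2 * \<sigma> + y') + D * (a2 * \<sigma> + y')\<^sup>2"
    moreover have "q \<le> (Q + \<eta>) * \<sigma>\<^sup>2 + 2 * C1 * (y\<^sup>2 + y'\<^sup>2)"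
      unfolding q_def Q_def C1_def by (rule quadratic_form_shift[OF \<eta>])
    moreover note quad[OF that, folded q_def]
    ultimately show ?thesis unfolding distrib_left distrib_right add_divide_distrib by linarith
  qed
  have "a1\<^sup>2 * b1 * s\<^sup>2 + a2\<^sup>2 * b2 * s\<^sup>2 \<le> (Q + \<eta>) / 2 * s\<^sup>2 + (Q + \<eta>) / 2 * (- s)\<^sup>2"
    using upper[OF 1(1,2) 2(1,2)] upper[OF 1(3,4) 2(3,4)] 1(5) 2(5) by linarith
  then have "(a1\<^sup>2 * b1 + a2\<^sup>2 * b2) * s\<^sup>2 \<le> (Q + \<eta>) * s\<^sup>2"
    by (simp add: distrib_right)
  then have "a1\<^sup>2 * b1 + a2\<^sup>2 * b2 \<le> Q + \<eta>" using s(1) by simp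
  then show "a1\<^sup>2 * b1 + a2\<^sup>2 * b2 \<le> A * a1\<^sup>2 + 2 * B * a1 * a2 + D * a2\<^sup>2 + \<eta>"
    by (simp add: Q_def)
qed

section \<open>Quadratic test functions\<close>

lemma C2_on_quadratic:
  fixes t r :: real
  shows "C2_on S (\<lambda>z. k + \<alpha> * (fst z - t) + N * (fst z - t)\<^sup>2 + p * (snd z - r) + X / 2 * (snd z - r)\<^sup>2)"
proof -
  define e1 e2 :: "(real \<times> real) \<Rightarrow>\<^sub>L real" where "e1 = Blinfun fst" and "e2 = Blinfun snd"
  have e: "blinfun_apply e1 = fst" "blinfun_apply e2 = snd"
    unfolding e1_def e2_def
    by (auto intro!: bounded_linear_Blinfun_apply bounded_linear_fst bounded_linear_snd)
  define G where "G z = (\<alpha> + 2 * N * (fst z - t)) *\<^sub>R e1 + (p + X * (snd z - r)) *\<^sub>R e2" for z :: "real \<times> real"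
  define H where "H = (\<lambda>h :: real \<times> real. (2 * N * fst h) *\<^sub>R e1 + (X * snd h) *\<^sub>R e2)"
  have H: "bounded_linear H"
    unfolding H_def by (intro bounded_linear_add bounded_linear_scaleR_const
        bounded_linear_const_mult bounded_linear_fst bounded_linear_snd)
  have "(G has_derivative blinfun_apply (Blinfun H)) (at z within S)" for z
    unfolding bounded_linear_Blinfun_apply[OF H] unfolding G_def H_def
    by (auto intro!: derivative_eq_intros)
  then have "C1_on S G"
    unfolding C1_on_def by (intro exI[of _ "\<lambda>_. Blinfun H"]) auto
  moreover have "((\<lambda>z. k + \<alpha> * (fst z - t) + N * (fst z - t)\<^sup>2 + p * (snd z - r) + X / 2 * (snd z - r)\<^sup>2)
      has_derivative blinfun_apply (G z)) (at z within S)" for z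
  proof -
    have "blinfun_apply (G z) = (\<lambda>h. (\<alpha> + 2 * N * (fst z - t)) * fst h + (p + X * (snd z - r)) * snd h)"
      by (simp add: G_def blinfun.add_left blinfun.scaleR_left e fun_eq_iff)
    then show ?thesis
      by (auto intro!: derivative_eq_intros simp: field_simps)
  qed
  ultimately show ?thesis unfolding C2_on_def by blast
qed

lemma quadratic_test_derivatives:
  fixes t r k \<alpha> N p X :: real
  defines "\<phi> \<equiv> \<lambda>z. k + \<alpha> * (fst z - t) + N * (fst z - t)\<^sup>2 + p * (snd z - r) + X / 2 * (snd z - r)\<^sup>2"
  shows "d_t \<phi> t r = \<alpha>" "d_r \<phi> t r = p" "d_rr \<phi> t r = X"
proof -
  show "d_t \<phi> t r = \<alpha>"
    unfolding d_t_def \<phi>_def by (rule DERIV_imp_deriv) (auto intro!: derivative_eq_intros)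
  have dr: "d_r \<phi> t x = p + X * (x - r)" for x
    unfolding d_r_def \<phi>_def by (rule DERIV_imp_deriv) (auto intro!: derivative_eq_intros)
  then show "d_r \<phi> t r = p" by simp
  show "d_rr \<phi> t r = X"
    unfolding d_rr_def dr by (rule DERIV_imp_deriv) (auto intro!: derivative_eq_intros)
qed

lemma touches_above_local_max:
  assumes "touches_above u t r \<alpha> p X" "(t, r) \<in> S"
  obtains N where "local_max_on S
    (\<lambda>z. u z - (u (t, r) + \<alpha> * (fst z - t) + N * (fst z - t)\<^sup>2 + p * (snd z - r) + X / 2 * (snd z - r)\<^sup>2)) (t, r)"
proof -
  obtain N e where e: "e > 0" and u: "\<And>t' x'. \<bar>t' - t\<bar> < e \<Longrightarrow> \<bar>x' - r\<bar> < e \<Longrightarrow>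
     u (t', x') \<le> u (t, r) + \<alpha> * (t' - t) + N * (t' - t)\<^sup>2 + p * (x' - r) + X / 2 * (x' - r)\<^sup>2"
    using assms(1) unfolding touches_above_def by blast
  have "\<forall>\<^sub>F z in at (t, r) within S. u z \<le> u (t, r) + \<alpha> * (fst z - t) + N * (fst z - t)\<^sup>2
      + p * (snd z - r) + X / 2 * (snd z - r)\<^sup>2"
    unfolding eventually_at
  proof (intro exI conjI ballI impI)
    show "e > 0" by fact
    fix z assume "z \<noteq> (t, r) \<and> dist z (t, r) < e"
    then have "dist (fst z) t < e" "dist (snd z) r < e"
      using dist_fst_le[of z "(t, r)"] dist_snd_le[of z "(t, r)"] by auto
    then show "u z \<le> u (t, r) + \<alpha> * (fst z - t) + N * (fst z - t)\<^sup>2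
      + p * (snd z - r) + X / 2 * (snd z - r)\<^sup>2"
      using u[of "fst z" "snd z"] by (simp add: dist_real_def)
  qed
  then show thesis
    by (intro that[of N]) (auto simp: local_max_on_def assms(2) elim!: eventually_mono)
qed

lemma subsolution_touches_above:
  assumes sub: "viscosity_subsolution c T u0 u" and pt: "0 < t" "ereal t < T" "0 < r"
    and touch: "touches_above u t r \<alpha> p X"
  shows "r * \<alpha> \<le> Fbar c r p X"
proof -
  have "(t, r) \<in> spacetime T" using pt by (auto simp: spacetime_def)
  from touches_above_local_max[OF touch this] obtain N where N: "local_max_on (spacetime T)
    (\<lambda>z. u z - (u (t, r) + \<alpha> * (fst z - t) + N * (fst z - t)\<^sup>2 + p * (snd z - r) + X / 2 * (snd z - r)\<^sup>2)) (t, r)" .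
  let ?\<phi> = "\<lambda>z. u (t, r) + \<alpha> * (fst z - t) + N * (fst z - t)\<^sup>2 + p * (snd z - r) + X / 2 * (snd z - r)\<^sup>2"
  from sub N have "t > 0 \<longrightarrow> r * d_t ?\<phi> t r \<le> Fbar c r (d_r ?\<phi> t r) (d_rr ?\<phi> t r)"
    using C2_on_quadratic[of "spacetime T" "u (t, r)" \<alpha> t N p r X]
    unfolding viscosity_subsolution_def by blast
  then show ?thesis using pt(1) unfolding quadratic_test_derivatives by blast
qed

text \<open>A super-solution \<open>v\<close> enters through \<open>-v\<close>, which behaves like a sub-solution for \<open>-c\<close>.\<close>

lemma supersolution_touches_above:
  assumes super: "viscosity_supersolution c T u0 v" and pt: "0 < t" "ereal t < T" "0 < r"
    and touch: "touches_above (\<lambda>z. - v z) t r \<alpha> p X"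
  shows "r * \<alpha> \<le> Fbar (- c) r p X"
proof -
  have "(t, r) \<in> spacetime T" using pt by (auto simp: spacetime_def)
  from touches_above_local_max[OF touch this] obtain N where N: "local_max_on (spacetime T)
    (\<lambda>z. - v z - (- v (t, r) + \<alpha> * (fst z - t) + N * (fst z - t)\<^sup>2 + p * (snd z - r) + X / 2 * (snd z - r)\<^sup>2)) (t, r)" .
  let ?\<phi> = "\<lambda>z. v (t, r) + (- \<alpha>) * (fst z - t) + (- N) * (fst z - t)\<^sup>2 + (- p) * (snd z - r)
      + (- X) / 2 * (snd z - r)\<^sup>2"
  have "local_min_on (spacetime T)
    (\<lambda>z. v z - (v (t, r) + (- \<alpha>) * (fst z - t) + (- N) * (fst z - t)\<^sup>2 + (- p) * (snd z - r)
      + (- X) / 2 * (snd z - r)\<^sup>2)) (t, r)"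
    using N unfolding local_max_on_def local_min_on_def by (auto elim!: eventually_mono)
  with super have "t > 0 \<longrightarrow> r * d_t ?\<phi> t r \<ge> Fbar c r (d_r ?\<phi> t r) (d_rr ?\<phi> t r)"
    using C2_on_quadratic[of "spacetime T" "v (t, r)" "- \<alpha>" t "- N" "- p" r "- X"]
    unfolding viscosity_supersolution_def by blast
  then have "r * (- \<alpha>) \<ge> Fbar c r (- p) (- X)"
    using pt(1) unfolding quadratic_test_derivatives by blast
  moreover have "Fbar (- c) r p X = - Fbar c r (- p) (- X)"
    by (simp add: Fbar_def)
  ultimately show ?thesis by simp
qed

lemma touches_above_affine:
  assumes "touches_above (\<lambda>z. u (t0 + fst z, r0 + snd z) - \<alpha>0 * fst z - p0 * snd z) t x \<alpha> p X"
  shows "touches_above u (t0 + t) (r0 + x) (\<alpha>0 + \<alpha>) (p0 + p) X"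
proof -
  obtain N e where e: "e > 0" and u: "\<And>t' x'. \<bar>t' - t\<bar> < e \<Longrightarrow> \<bar>x' - x\<bar> < e \<Longrightarrow>
     u (t0 + t', r0 + x') - \<alpha>0 * t' - p0 * x' \<le> u (t0 + t, r0 + x) - \<alpha>0 * t - p0 * x
       + \<alpha> * (t' - t) + N * (t' - t)\<^sup>2 + p * (x' - x) + X / 2 * (x' - x)\<^sup>2"
    using assms unfolding touches_above_def by auto
  show ?thesis
    unfolding touches_above_def
  proof (rule exI[of _ N], rule exI[of _ e], intro conjI allI impI e)
    fix t' x' assume "\<bar>t' - (t0 + t)\<bar> < e" "\<bar>x' - (r0 + x)\<bar> < e"
    then have "\<bar>(t' - t0) - t\<bar> < e" "\<bar>(x' - r0) - x\<bar> < e" by (simp_all add: algebra_simps)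
    from u[OF this] show "u (t', x') \<le> u (t0 + t, r0 + x) + (\<alpha>0 + \<alpha>) * (t' - (t0 + t))
       + N * (t' - (t0 + t))\<^sup>2 + (p0 + p) * (x' - (r0 + x)) + X / 2 * (x' - (r0 + x))\<^sup>2"
      by (simp add: algebra_simps)
  qed
qed

section \<open>The equation as a constant lower bound on curvature\<close>

lemma Fbar_mono: "0 < r \<Longrightarrow> Y \<le> Z \<Longrightarrow> Fbar c r q Y \<le> Fbar c r q Z"
  unfolding Fbar_def by (intro add_left_mono divide_right_mono mult_left_mono) auto

text \<open>The strict inequality at the centre is an open condition in the radius and the two
  slopes. A touching parabola with X < b would, by monotonicity of \<open>Fbar\<close> in its last
  argument, violate it at a nearby point.\<close>

lemma touching_bound_near:
  fixes t0 r0 :: real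
  assumes eqn: "\<And>t r \<alpha> p X. 0 < t \<Longrightarrow> ereal t < T \<Longrightarrow> 0 < r \<Longrightarrow> touches_above u t r \<alpha> p X \<Longrightarrow>
      r * \<alpha> \<le> Fbar c r p X"
    and pt: "0 < t0" "ereal t0 < T" "0 < r0" and strict: "Fbar c r0 p0 b < r0 * \<alpha>0"
  shows "\<exists>\<delta>>0. \<forall>t x \<alpha> p X. \<bar>t\<bar> < \<delta> \<longrightarrow> \<bar>x\<bar> < \<delta> \<longrightarrow> \<bar>\<alpha>\<bar> < \<delta> \<longrightarrow> \<bar>p\<bar> < \<delta> \<longrightarrow>
    touches_above (\<lambda>z. u (t0 + fst z, r0 + snd z) - \<alpha>0 * fst z - p0 * snd z) t x \<alpha> p X \<longrightarrow> b \<le> X"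
proof -
  define g where "g z = (r0 + fst z) * (\<alpha>0 + fst (snd z)) - Fbar c (r0 + fst z) (p0 + snd (snd z)) b"
    for z :: "real \<times> real \<times> real"
  have pos: "1 + (a::real)\<^sup>2 * b\<^sup>2 \<noteq> 0" for a b
    by (metis add_pos_nonneg less_numeral_extra(1,3) zero_le_power2 mult_nonneg_nonneg)
  have "continuous_on UNIV g"
    unfolding g_def Fbar_def by (intro continuous_intros ballI pos)
  then have "open (g -` {0<..})"
    by (intro open_vimage) auto
  moreover have "(0, 0, 0) \<in> g -` {0<..}" using strict by (simp add: g_def)
  ultimately obtain d where d: "d > 0" "\<And>z. dist z (0,0,0) < d \<Longrightarrow> 0 < g z"
    unfolding open_dist by (metis greaterThan_iff vimage_eq)
  obtain e where e: "e > 0" "\<And>t. \<bar>t - t0\<bar> < e \<Longrightarrow> ereal t < T"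
  proof (cases T)
    case (real T')
    then show ?thesis using pt by (intro that[of "T' - t0"]) auto
  qed (use pt that[of 1] in auto)
  define \<delta> where "\<delta> = min (min (d / 3) e) (min t0 r0)"
  have \<delta>: "\<delta> > 0" "\<delta> \<le> d / 3" "\<delta> \<le> e" "\<delta> \<le> t0" "\<delta> \<le> r0"
    using d e pt by (auto simp: \<delta>_def)
  have "b \<le> X" if *: "\<bar>t\<bar> < \<delta>" "\<bar>x\<bar> < \<delta>" "\<bar>\<alpha>\<bar> < \<delta>" "\<bar>p\<bar> < \<delta>"
    "touches_above (\<lambda>z. u (t0 + fst z, r0 + snd z) - \<alpha>0 * fst z - p0 * snd z) t x \<alpha> p X" for t x \<alpha> p X
  proof (rule ccontr)
    assume "\<not> b \<le> X"
    have pos: "0 < t0 + t" "0 < r0 + x" "ereal (t0 + t) < T" using * \<delta> by (auto intro!: e(2))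
    have "(r0 + x) * (\<alpha>0 + \<alpha>) \<le> Fbar c (r0 + x) (p0 + p) X"
      by (rule eqn[OF pos(1,3,2) touches_above_affine[OF *(5)]])
    also have "\<dots> \<le> Fbar c (r0 + x) (p0 + p) b"
      using pos \<open>\<not> b \<le> X\<close> by (intro Fbar_mono) auto
    finally have "g (x, \<alpha>, p) \<le> 0" by (simp add: g_def)
    moreover have "dist (x, \<alpha>, p) (0, 0, 0) \<le> \<bar>x\<bar> + (\<bar>\<alpha>\<bar> + \<bar>p\<bar>)"
    proof -
      have "norm (x, \<alpha>, p) \<le> norm x + norm (\<alpha>, p)" "norm (\<alpha>, p) \<le> norm \<alpha> + norm p"
        by (rule norm_Pair_le)+
      then show ?thesis by (simp add: dist_norm)
    qed
    moreover have "\<bar>x\<bar> + (\<bar>\<alpha>\<bar> + \<bar>p\<bar>) < d" using * \<delta> by linarith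
    ultimately show False using d(2)[of "(x, \<alpha>, p)"] by simp
  qed
  with \<delta>(1) show ?thesis by blast
qed

section \<open>The doubling estimate\<close>

lemma inverse_sqrt_diff_square_le:
  fixes p p' :: real
  shows "(1 / sqrt (1 + p\<^sup>2) - 1 / sqrt (1 + p'\<^sup>2))\<^sup>2 \<le> (p - p')\<^sup>2 / ((1 + p\<^sup>2) * (1 + p'\<^sup>2))"
proof -
  define a b where "a = sqrt (1 + p\<^sup>2)" and "b = sqrt (1 + p'\<^sup>2)"
  have pos: "0 < 1 + p\<^sup>2" "0 < 1 + p'\<^sup>2" by (auto intro: add_pos_nonneg)
  then have ab: "a > 0" "b > 0" "a\<^sup>2 = 1 + p\<^sup>2" "b\<^sup>2 = 1 + p'\<^sup>2"
    by (auto simp: a_def b_def)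
  \<comment> \<open>Cauchy-Schwarz for the vectors (1, p) and (1, p'), whose lengths are a and b; it
    gives |b - a| <= |p - p'|.\<close>
  have "1 + p * p' \<le> a * b"
  proof (rule power2_le_imp_le)
    have "0 \<le> (p - p')\<^sup>2" by simp
    then show "(1 + p * p')\<^sup>2 \<le> (a * b)\<^sup>2"
      unfolding power_mult_distrib ab by (simp add: power2_eq_square algebra_simps)
  qed (use ab in simp)
  moreover have "(b - a)\<^sup>2 = 2 + p\<^sup>2 + p'\<^sup>2 - 2 * (a * b)"
    unfolding power2_diff ab by simp
  ultimately have "(b - a)\<^sup>2 \<le> (p - p')\<^sup>2" unfolding power2_diff[of p] by linarith
  then have "(b - a)\<^sup>2 / (a\<^sup>2 * b\<^sup>2) \<le> (p - p')\<^sup>2 / (a\<^sup>2 * b\<^sup>2)"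
    by (intro divide_right_mono) auto
  moreover have "(1 / a - 1 / b)\<^sup>2 = (b - a)\<^sup>2 / (a\<^sup>2 * b\<^sup>2)"
  proof -
    have "1 / a - 1 / b = (b - a) / (a * b)" using ab by (simp add: field_simps)
    then show ?thesis by (simp add: power_divide power_mult_distrib)
  qed
  ultimately show ?thesis unfolding ab a_def[symmetric] b_def[symmetric] by simp
qed

lemma inverse_sqrt_lipschitz:
  fixes p p' :: real
  shows "\<bar>1 / sqrt (1 + p\<^sup>2) - 1 / sqrt (1 + p'\<^sup>2)\<bar> \<le> \<bar>p - p'\<bar>"
proof -
  have "1 * 1 \<le> (1 + p\<^sup>2) * (1 + p'\<^sup>2)" by (intro mult_mono) auto
  then have "(p - p')\<^sup>2 / ((1 + p\<^sup>2) * (1 + p'\<^sup>2)) \<le> (p - p')\<^sup>2 / 1"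
    by (intro divide_left_mono) auto
  with inverse_sqrt_diff_square_le[of p p'] show ?thesis
    unfolding abs_le_square_iff by linarith
qed

text \<open>The bound must not depend on q, which is of size (r - \<rho>)/\<epsilon>. The product in
  the denominator dominates (r q + \<rho> q)^2 >= 4 r \<rho> q^2, so q cancels. The constant 1/4
  matters: after a doubling by the triangle inequality, half of the good term is still left for the
  forcing.\<close>

lemma inverse_sqrt_scaling_le:
  fixes r \<rho> q :: real
  assumes "r > 0" "\<rho> > 0"
  shows "(1 / sqrt (1 + (r * q)\<^sup>2) - 1 / sqrt (1 + (\<rho> * q)\<^sup>2))\<^sup>2 \<le> (r - \<rho>)\<^sup>2 / (4 * (r * \<rho>))"
proof (cases "q = 0")
  case True
  then show ?thesis using assms by simp
next
  case False
  have "4 * (r * \<rho>) * q\<^sup>2 \<le> (r * q + \<rho> * q)\<^sup>2"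
  proof -
    have "0 \<le> (r * q - \<rho> * q)\<^sup>2" by simp
    then show ?thesis by (simp add: power2_eq_square algebra_simps)
  qed
  also have "\<dots> \<le> (1 + (r * q)\<^sup>2) * (1 + (\<rho> * q)\<^sup>2)"
  proof -
    have "0 \<le> (1 - (r * q) * (\<rho> * q))\<^sup>2" by simp
    then show ?thesis by (simp add: power2_eq_square algebra_simps)
  qed
  finally have *: "4 * (r * \<rho>) * q\<^sup>2 \<le> (1 + (r * q)\<^sup>2) * (1 + (\<rho> * q)\<^sup>2)" .
  note inverse_sqrt_diff_square_le[of "r * q" "\<rho> * q"]
  also have "(r * q - \<rho> * q)\<^sup>2 / ((1 + (r * q)\<^sup>2) * (1 + (\<rho> * q)\<^sup>2)) \<le> (r * q - \<rho> * q)\<^sup>2 / (4 * (r * \<rho>) * q\<^sup>2)"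
    using * assms False by (intro divide_left_mono mult_pos_pos add_pos_nonneg) auto
  also have "\<dots> = (r - \<rho>)\<^sup>2 / (4 * (r * \<rho>))"
  proof -
    have "(r * q - \<rho> * q)\<^sup>2 = (r - \<rho>)\<^sup>2 * q\<^sup>2" by (simp add: power2_eq_square algebra_simps)
    then show ?thesis using False by simp
  qed
  finally show ?thesis .
qed

lemma sqrt_sum_squares_diff_le:
  fixes x y x' y' :: real
  shows "\<bar>sqrt (x\<^sup>2 + y\<^sup>2) - sqrt (x'\<^sup>2 + y'\<^sup>2)\<bar> \<le> \<bar>x - x'\<bar> + \<bar>y - y'\<bar>"
proof -
  have "\<bar>norm (x, y) - norm (x', y')\<bar> \<le> norm ((x, y) - (x', y'))"
    by (rule norm_triangle_ineq3)
  also have "\<dots> \<le> \<bar>x - x'\<bar> + \<bar>y - y'\<bar>"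
    using norm_Pair_le[of "x - x'" "y - y'"] by simp
  finally show ?thesis by (simp add: norm_Pair)
qed

text \<open>The terms of \<open>Fbar c r q Y / r\<close> free of Y, with (2 + p^2)/(1 + p^2) written
  as 1 + 1/(1 + p^2) for p = r q, to separate the pure q/r from its decaying companion.\<close>

definition first_order :: "real \<Rightarrow> real \<Rightarrow> real \<Rightarrow> real" where
  "first_order c r q = c * sqrt (1 + (r * q)\<^sup>2) / r + q * (1 + 1 / (1 + (r * q)\<^sup>2)) / r"

lemma Fbar_first_order:
  assumes "r > 0"
  shows "Fbar c r q Y = r * (first_order c r q + Y / (1 + (r * q)\<^sup>2))"
proof -
  have pos: "1 + r\<^sup>2 * q\<^sup>2 \<noteq> 0"
    by (metis add_pos_nonneg less_numeral_extra(1,3) zero_le_power2 mult_nonneg_nonneg)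
  then have "(2 + r\<^sup>2 * q\<^sup>2) / (1 + r\<^sup>2 * q\<^sup>2) = 1 + 1 / (1 + r\<^sup>2 * q\<^sup>2)"
    by (simp add: divide_simps)
  moreover have "r * first_order c r q = c * sqrt (1 + r\<^sup>2 * q\<^sup>2) + q * (1 + 1 / (1 + r\<^sup>2 * q\<^sup>2))"
    using assms unfolding first_order_def distrib_left[of r] power_mult_distrib by simp
  ultimately show ?thesis
    unfolding Fbar_def distrib_left[of r] power_mult_distrib by simp
qed

text \<open>\<open>\<alpha> (\<tau> - 1)\<close> is the change of \<open>p\<close> caused by \<open>\<alpha> (ln (1 + r\<^sup>2) - ln r)\<close>. The first-order gain
  \<open>-\<alpha>\<close> near \<open>r = 0\<close> survives the change of the diffusion coefficient, which costs at most \<open>3 \<alpha> / 4\<close>.\<close>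

lemma penalty_gain:
  fixes p \<alpha> \<tau> :: real
  assumes \<alpha>: "0 \<le> \<alpha>" "\<alpha> \<le> 1/2" and \<tau>: "0 \<le> \<tau>" "\<tau> \<le> 2"
  defines "p1 \<equiv> p + \<alpha> * (\<tau> - 1)"
  shows "p1 * (1 + 1 / (1 + p1\<^sup>2)) - p * (1 + 1 / (1 + p\<^sup>2)) + \<alpha> * (\<tau> + 9/8) * (1 / (1 + p1\<^sup>2))
    \<le> - \<alpha> / 8 + 3 * \<alpha> * \<tau>"
proof -
  define h where "h = \<alpha> * (\<tau> - 1)"
  have h: "\<bar>h\<bar> \<le> \<alpha>" using \<alpha> \<tau> by (auto simp: h_def abs_mult intro!: mult_left_le)
  have p1: "p1 = p + h" by (simp add: p1_def h_def)
  define g1 g where "g1 = 1 / (1 + p1\<^sup>2)" and "g = 1 / (1 + p\<^sup>2)"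
  have pos: "0 < 1 + p\<^sup>2" "0 < 1 + p1\<^sup>2" by (auto intro: add_pos_nonneg)
  then have g1: "0 \<le> g1" "g1 \<le> 1" by (auto simp: g1_def)
  define E where "E = (1 + p\<^sup>2) * (1 + p1\<^sup>2)"
  have E: "E > 0" unfolding E_def using pos by simp
  have half: "\<bar>x\<bar> \<le> (1 + x\<^sup>2) / 2" for x :: real
    using zero_le_power2[of "\<bar>x\<bar> - 1"] by (simp add: power2_eq_square algebra_simps)
  have "\<bar>p\<bar> * \<bar>p1\<bar> \<le> (1 + p\<^sup>2) / 2 * ((1 + p1\<^sup>2) / 2)"
    by (intro mult_mono half) auto
  then have 1: "\<bar>p\<bar> * \<bar>p1\<bar> \<le> E / 4" by (simp add: E_def)
  have "(1 + p\<^sup>2) * 1 \<le> (1 + p\<^sup>2) * (1 + p1\<^sup>2)" by (intro mult_left_mono) auto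
  then have 2: "\<bar>p\<bar> * (1/2) \<le> E / 4" using half[of p] by (simp add: E_def)
  \<comment> \<open>Since |p - p1| <= 1/2, one factor |p| may be replaced by |p1| + 1/2. This leaves
    2 |p| |p1| + |p|/2, that is, three quantities of at most E/4 each.\<close>
  have "p\<^sup>2 = \<bar>p\<bar> * \<bar>p\<bar>" by (simp add: power2_eq_square)
  also have "\<dots> \<le> \<bar>p\<bar> * (\<bar>p1\<bar> + 1/2)" using h \<alpha> p1 by (intro mult_left_mono) auto
  finally have 3: "p\<^sup>2 + \<bar>p\<bar> * \<bar>p1\<bar> \<le> 3/4 * E" using 1 2 by (simp add: distrib_left)
  have "p * (g1 - g) = - h * (p\<^sup>2 + p * p1) / E"
  proof -
    have "g1 - g = ((1 + p\<^sup>2) - (1 + p1\<^sup>2)) / E"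
      unfolding g1_def g_def E_def using pos by (simp add: field_simps)
    also have "(1 + p\<^sup>2) - (1 + p1\<^sup>2) = - h * (p + p1)"
      unfolding p1 by (simp add: power2_eq_square algebra_simps)
    finally show ?thesis by (simp add: power2_eq_square algebra_simps)
  qed
  also have "\<dots> \<le> \<alpha> * (3/4 * E) / E"
  proof (rule divide_right_mono)
    have "- h * (p\<^sup>2 + p * p1) \<le> \<bar>h\<bar> * \<bar>p\<^sup>2 + p * p1\<bar>"
      by (metis abs_ge_self abs_minus_cancel abs_mult)
    also have "\<dots> \<le> \<alpha> * (3/4 * E)"
    proof (rule mult_mono)
      have "\<bar>p\<^sup>2 + p * p1\<bar> \<le> p\<^sup>2 + \<bar>p\<bar> * \<bar>p1\<bar>"
        using abs_triangle_ineq[of "p\<^sup>2" "p * p1"] by (simp add: abs_mult)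
      then show "\<bar>p\<^sup>2 + p * p1\<bar> \<le> 3/4 * E" using 3 by simp
    qed (use h \<alpha> in auto)
    finally show "- h * (p\<^sup>2 + p * p1) \<le> \<alpha> * (3/4 * E)" .
  qed (use E in simp)
  also have "\<dots> = 3/4 * \<alpha>" using E by simp
  finally have 4: "p * (g1 - g) \<le> 3/4 * \<alpha>" .
  have "g1 * (\<alpha> * (2 * \<tau> + 1/8)) \<le> 1 * (\<alpha> * (2 * \<tau> + 1/8))"
    using g1 \<alpha> \<tau> by (intro mult_right_mono) auto
  \<comment> \<open>Writing p1 g1 = p g1 + \<alpha> (\<tau> - 1) g1 lets the -1 cancel all but 1/8
    of the curvature weight 9/8. The total of the terms without \<tau> is then -1 + 3/4 + 1/8 =
    -1/8.\<close>
  moreover have "p1 * (1 + g1) - p * (1 + g) + \<alpha> * (\<tau> + 9/8) * g1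
      = \<alpha> * (\<tau> - 1) + p * (g1 - g) + g1 * (\<alpha> * (2 * \<tau> + 1/8))"
    unfolding p1 h_def by (simp add: algebra_simps)
  ultimately show ?thesis
    using 4 unfolding g1_def[symmetric] g_def[symmetric] by (simp add: algebra_simps)
qed

text \<open>Splitting off q/r leaves q k(r) with k decreasing. As q has the sign of r - \<rho>, the
  k part has a good sign, and q/r - q/\<rho> is exactly the right-hand side.\<close>

lemma divergence_term_decreasing:
  fixes r \<rho> q \<epsilon> :: real
  assumes "r > 0" "\<rho> > 0" "\<epsilon> > 0" and q: "q = (r - \<rho>) / \<epsilon>"
  shows "q * (1 + 1 / (1 + (r * q)\<^sup>2)) / r - q * (1 + 1 / (1 + (\<rho> * q)\<^sup>2)) / \<rho>
    \<le> - (r - \<rho>)\<^sup>2 / (\<epsilon> * (r * \<rho>))"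
proof -
  define k where "k x = 1 / ((1 + (x * q)\<^sup>2) * x)" for x
  have k: "k y \<le> k x" if "0 < x" "x \<le> y" for x y
    unfolding k_def
  proof (rule divide_left_mono)
    have "(x * q)\<^sup>2 \<le> (y * q)\<^sup>2"
      using that by (simp add: power_mult_distrib mult_right_mono power_mono)
    then show "(1 + (x * q)\<^sup>2) * x \<le> (1 + (y * q)\<^sup>2) * y"
      using that by (intro mult_mono) auto
    show "0 < (1 + (y * q)\<^sup>2) * y * ((1 + (x * q)\<^sup>2) * x)"
      using that by (intro mult_pos_pos add_pos_nonneg) auto
  qed simp
  have "q * (k r - k \<rho>) \<le> 0"
  proof (cases "r \<le> \<rho>")
    case True
    then show ?thesis using k[OF assms(1) True] assms
      by (intro mult_nonpos_nonneg) (auto simp: divide_nonpos_pos)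
  next
    case False
    then show ?thesis using k[of \<rho> r] assms
      by (intro mult_nonneg_nonpos) auto
  qed
  moreover have "q * (1 + 1 / (1 + (x * q)\<^sup>2)) / x = q / x + q * k x" for x
    by (simp add: k_def distrib_left add_divide_distrib)
  moreover have "q / r - q / \<rho> = - (r - \<rho>)\<^sup>2 / (\<epsilon> * (r * \<rho>))"
    unfolding q using assms by (simp add: divide_simps) (simp add: power2_eq_square algebra_simps)
  ultimately show ?thesis by (simp add: right_diff_distrib)
qed

text \<open>\<open>pen_deriv\<close> is the derivative of \<open>ln (1 + r\<^sup>2) - ln r\<close> and \<open>pen_curv\<close> an upper bound for its
  second derivative; the weight \<open>9/8\<close> instead of \<open>1\<close> leaves room for a quadratic upper bound.\<close>

definition pen_deriv :: "real \<Rightarrow> real" where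
  "pen_deriv r = 2 * r / (1 + r\<^sup>2) - 1 / r"

definition pen_curv :: "real \<Rightarrow> real" where
  "pen_curv r = 2 / (1 + r\<^sup>2) + 9 / (8 * r\<^sup>2)"

lemma mult_pen_deriv: "r > 0 \<Longrightarrow> r * pen_deriv r = 2 * r\<^sup>2 / (1 + r\<^sup>2) - 1"
  by (simp add: pen_deriv_def right_diff_distrib power2_eq_square)

lemma square_mult_pen_curv: "r > 0 \<Longrightarrow> r\<^sup>2 * pen_curv r = 2 * r\<^sup>2 / (1 + r\<^sup>2) + 9 / 8"
  by (simp add: pen_curv_def distrib_left)

text \<open>The ratio is \<open>1 + r * pen_deriv r\<close>. The bounds 0 and 2 keep the
  perturbation of p = r q within \<alpha>; the bound 2 r^2 makes its bad contribution harmless near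
  r = 0.\<close>

lemma pen_ratio:
  fixes r :: real
  shows "0 \<le> 2 * r\<^sup>2 / (1 + r\<^sup>2)" "2 * r\<^sup>2 / (1 + r\<^sup>2) \<le> 2" "2 * r\<^sup>2 / (1 + r\<^sup>2) \<le> 2 * r\<^sup>2"
proof -
  have pos: "0 < 1 + r\<^sup>2" by (auto intro: add_pos_nonneg)
  then show "0 \<le> 2 * r\<^sup>2 / (1 + r\<^sup>2)" "2 * r\<^sup>2 / (1 + r\<^sup>2) \<le> 2"
    by (auto simp: pos_divide_le_eq)
  have "2 * r\<^sup>2 * 1 \<le> 2 * r\<^sup>2 * (1 + r\<^sup>2)" by (intro mult_left_mono) auto
  then show "2 * r\<^sup>2 / (1 + r\<^sup>2) \<le> 2 * r\<^sup>2" using pos by (simp add: pos_divide_le_eq)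
qed

lemma abs_mult_pen_deriv_le: "r > 0 \<Longrightarrow> \<bar>r * pen_deriv r\<bar> \<le> 1"
  unfolding mult_pen_deriv using pen_ratio(1,2)[of r] by linarith

text \<open>Multiplied by r^2, the claim is \<open>penalty_gain\<close> for p = r q. There
  -\<alpha>/8 becomes the singular gain, and 3 \<alpha> \<tau> <= 6 \<alpha> r^2 becomes the bounded
  error.\<close>

lemma penalty_gain_radial:
  fixes r q \<alpha> :: real
  assumes r: "r > 0" and \<alpha>: "0 \<le> \<alpha>" "\<alpha> \<le> 1/2"
  defines "q1 \<equiv> q + \<alpha> * pen_deriv r"
  shows "q1 * (1 + 1 / (1 + (r * q1)\<^sup>2)) / r - q * (1 + 1 / (1 + (r * q)\<^sup>2)) / r
      + \<alpha> * pen_curv r * (1 / (1 + (r * q1)\<^sup>2))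
    \<le> - (\<alpha> / 8) * (1 / r)\<^sup>2 + 6 * \<alpha>"
proof -
  define \<tau> where "\<tau> = 2 * r\<^sup>2 / (1 + r\<^sup>2)"
  have \<tau>: "0 \<le> \<tau>" "\<tau> \<le> 2" "\<tau> \<le> 2 * r\<^sup>2" unfolding \<tau>_def by (rule pen_ratio)+
  have rq1: "r * q1 = r * q + \<alpha> * (\<tau> - 1)"
    using mult_pen_deriv[OF r] by (simp add: q1_def \<tau>_def distrib_left mult.left_commute)
  have "r\<^sup>2 * (q1 * (1 + 1 / (1 + (r * q1)\<^sup>2)) / r - q * (1 + 1 / (1 + (r * q)\<^sup>2)) / r
      + \<alpha> * pen_curv r * (1 / (1 + (r * q1)\<^sup>2)))
    = (r * q1) * (1 + 1 / (1 + (r * q1)\<^sup>2)) - (r * q) * (1 + 1 / (1 + (r * q)\<^sup>2))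
      + \<alpha> * (r\<^sup>2 * pen_curv r) * (1 / (1 + (r * q1)\<^sup>2))" (is "?L = _")
  proof -
    have "r\<^sup>2 * (a * A / r - b * B / r + \<alpha> * P * G) = (r * a) * A - (r * b) * B + \<alpha> * (r\<^sup>2 * P) * G"
      for a A b B P G
      using r by (simp add: right_diff_distrib distrib_left power2_eq_square)
    then show ?thesis .
  qed
  also have "\<dots> \<le> - \<alpha> / 8 + 3 * \<alpha> * \<tau>"
    unfolding square_mult_pen_curv[OF r] \<tau>_def[symmetric] rq1
    by (rule penalty_gain) (use \<alpha> \<tau> in auto)
  also have "\<dots> \<le> - \<alpha> / 8 + 3 * \<alpha> * (2 * r\<^sup>2)"
    using \<alpha> \<tau> by (intro add_left_mono mult_left_mono) auto
  also have "\<dots> = r\<^sup>2 * (- (\<alpha> / 8) * (1 / r)\<^sup>2 + 6 * \<alpha>)"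
    using r by (simp add: field_simps)
  finally show ?thesis using r by simp
qed

text \<open>The budget, with D = (r - \<rho>)^2 / (\<epsilon> r \<rho>): the divergence term gives
  -D, of which diffusion and forcing use half each. The penalties give -(\<alpha>/8)(1/r^2 +
  1/\<rho>^2), spent entirely on the forcing. K = 4 c^2 + 1 is dictated by the need for c^2
  \<epsilon> <= \<alpha>/4.\<close>

lemma doubling_estimate:
  fixes c r \<rho> \<epsilon> :: real
  assumes r: "r > 0" and \<rho>: "\<rho> > 0" and \<epsilon>: "\<epsilon> > 0"
  defines "K \<equiv> 4 * c\<^sup>2 + 1"
  defines "\<alpha> \<equiv> K * \<epsilon>" and "q \<equiv> (r - \<rho>) / \<epsilon>"
  defines "q1 \<equiv> q + \<alpha> * pen_deriv r" and "q2 \<equiv> q - \<alpha> * pen_deriv \<rho>"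
  defines "s1 \<equiv> 1 / sqrt (1 + (r * q1)\<^sup>2)" and "s2 \<equiv> 1 / sqrt (1 + (\<rho> * q2)\<^sup>2)"
  assumes small: "\<alpha> \<le> 1/2"
  shows "first_order c r q1 - first_order c \<rho> q2 + (s1 - s2)\<^sup>2 / \<epsilon>
     + \<alpha> * (pen_curv r * s1\<^sup>2 + pen_curv \<rho> * s2\<^sup>2) \<le> (8 * K\<^sup>2 + 12 * K + 8 * c\<^sup>2 * K) * \<epsilon>"
proof -
  have K: "K \<ge> 1" "c\<^sup>2 \<le> K / 4" by (auto simp: K_def)
  have \<alpha>: "0 \<le> \<alpha>" using K \<epsilon> by (simp add: \<alpha>_def)
  have sq: "s1\<^sup>2 = 1 / (1 + (r * q1)\<^sup>2)" "s2\<^sup>2 = 1 / (1 + (\<rho> * q2)\<^sup>2)"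
    unfolding s1_def s2_def by (auto simp: power_divide add_nonneg_nonneg)
  define D where "D = (r - \<rho>)\<^sup>2 / (\<epsilon> * (r * \<rho>))"
  define x y where "x = 1 / r" and "y = 1 / \<rho>"
  have xy: "x > 0" "y > 0" using r \<rho> by (auto simp: x_def y_def)
  have curvature: "(s1 - s2)\<^sup>2 / \<epsilon> \<le> D / 2 + 8 * K\<^sup>2 * \<epsilon>"
  proof -
    \<comment> \<open>The unperturbed coefficients share the slope q, so only the radii differ
      between them; passing to the perturbed slopes costs at most \<alpha> each.\<close>
    define e1 e2 where "e1 = 1 / sqrt (1 + (r * q)\<^sup>2)" and "e2 = 1 / sqrt (1 + (\<rho> * q)\<^sup>2)"
    have "\<bar>s1 - e1\<bar> \<le> \<bar>r * q1 - r * q\<bar>" "\<bar>s2 - e2\<bar> \<le> \<bar>\<rho> * q2 - \<rho> * q\<bar>"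
      unfolding s1_def s2_def e1_def e2_def by (rule inverse_sqrt_lipschitz)+
    moreover have "r * q1 - r * q = \<alpha> * (r * pen_deriv r)" "\<rho> * q2 - \<rho> * q = - (\<alpha> * (\<rho> * pen_deriv \<rho>))"
      by (simp_all add: q1_def q2_def algebra_simps)
    moreover have "\<bar>\<alpha> * (r * pen_deriv r)\<bar> \<le> \<alpha>" "\<bar>\<alpha> * (\<rho> * pen_deriv \<rho>)\<bar> \<le> \<alpha>"
      using abs_mult_pen_deriv_le[OF r] abs_mult_pen_deriv_le[OF \<rho>] \<alpha>
      by (simp_all add: abs_mult[of \<alpha>] mult_left_le)
    ultimately have "\<bar>(s1 - e1) - (s2 - e2)\<bar> \<le> 2 * \<alpha>" by linarith
    then have "((s1 - e1) - (s2 - e2))\<^sup>2 \<le> (2 * \<alpha>)\<^sup>2"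
      unfolding abs_le_square_iff[symmetric] using \<alpha> by linarith
    moreover have "(e1 - e2)\<^sup>2 \<le> (r - \<rho>)\<^sup>2 / (4 * (r * \<rho>))"
      unfolding e1_def e2_def by (rule inverse_sqrt_scaling_le[OF r \<rho>])
    moreover have "(s1 - s2)\<^sup>2 \<le> 2 * (e1 - e2)\<^sup>2 + 2 * ((s1 - e1) - (s2 - e2))\<^sup>2"
    proof -
      have "0 \<le> ((e1 - e2) - ((s1 - e1) - (s2 - e2)))\<^sup>2" by simp
      moreover have "(s1 - s2)\<^sup>2 + ((e1 - e2) - ((s1 - e1) - (s2 - e2)))\<^sup>2
          = 2 * (e1 - e2)\<^sup>2 + 2 * ((s1 - e1) - (s2 - e2))\<^sup>2"
        by (simp add: power2_eq_square algebra_simps)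
      ultimately show ?thesis by linarith
    qed
    moreover have "(2 * \<alpha>)\<^sup>2 = 4 * \<alpha>\<^sup>2" by (simp add: power_mult_distrib)
    ultimately have "(s1 - s2)\<^sup>2 \<le> 2 * ((r - \<rho>)\<^sup>2 / (4 * (r * \<rho>))) + 8 * \<alpha>\<^sup>2" by linarith
    then have "(s1 - s2)\<^sup>2 / \<epsilon> \<le> (2 * ((r - \<rho>)\<^sup>2 / (4 * (r * \<rho>))) + 8 * \<alpha>\<^sup>2) / \<epsilon>"
      using \<epsilon> by (intro divide_right_mono) auto
    also have "\<dots> = D / 2 + 8 * K\<^sup>2 * \<epsilon>"
      unfolding D_def \<alpha>_def using r \<rho> \<epsilon> by (simp add: field_simps power2_eq_square)
    finally show ?thesis .
  qed
  have forcing: "c * sqrt (1 + (r * q1)\<^sup>2) / r - c * sqrt (1 + (\<rho> * q2)\<^sup>2) / \<rho>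
      \<le> D / 2 + (\<alpha> / 16 * (x\<^sup>2 + y\<^sup>2)) + (\<alpha> / 16 * (x\<^sup>2 + y\<^sup>2) + 8 * c\<^sup>2 * \<alpha>)"
  proof -
    \<comment> \<open>The forcing is c times the Euclidean norm of (1/z, w), hence Lipschitz in the
      inverse radius and the slope.\<close>
    have form: "sqrt (1 + (z * w)\<^sup>2) / z = sqrt ((1 / z)\<^sup>2 + w\<^sup>2)" if "z > 0" for z w :: real
    proof -
      have "sqrt ((1 / z)\<^sup>2 + w\<^sup>2) = sqrt ((1 + (z * w)\<^sup>2) / z\<^sup>2)"
        using that by (simp add: field_simps)
      also have "\<dots> = sqrt (1 + (z * w)\<^sup>2) / z" using that by (simp add: real_sqrt_divide)
      finally show ?thesis by simp
    qed
    have "c * sqrt (1 + (r * q1)\<^sup>2) / r - c * sqrt (1 + (\<rho> * q2)\<^sup>2) / \<rho>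
      = c * (sqrt (x\<^sup>2 + q1\<^sup>2) - sqrt (y\<^sup>2 + q2\<^sup>2))"
      unfolding x_def y_def form[OF r, symmetric] form[OF \<rho>, symmetric] by (simp add: right_diff_distrib)
    also have "\<dots> \<le> \<bar>c\<bar> * \<bar>sqrt (x\<^sup>2 + q1\<^sup>2) - sqrt (y\<^sup>2 + q2\<^sup>2)\<bar>"
      by (metis abs_ge_self abs_mult)
    also have "\<dots> \<le> \<bar>c\<bar> * (\<bar>x - y\<bar> + \<bar>q1 - q2\<bar>)"
      by (intro mult_left_mono sqrt_sum_squares_diff_le) auto
    also have "\<dots> \<le> \<bar>c\<bar> * (\<bar>x - y\<bar> + (\<alpha> * x + \<alpha> * y))"
    proof (intro mult_left_mono add_left_mono)
      have "\<bar>pen_deriv z\<bar> \<le> 1 / z" if "z > 0" for z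
        using abs_mult_pen_deriv_le[OF that] that by (simp add: abs_mult field_simps)
      then have "\<bar>\<alpha> * pen_deriv r\<bar> \<le> \<alpha> * x" "\<bar>\<alpha> * pen_deriv \<rho>\<bar> \<le> \<alpha> * y"
        using r \<rho> \<alpha> by (auto simp: abs_mult x_def y_def simp del: times_divide_eq_right intro!: mult_left_mono)
      then show "\<bar>q1 - q2\<bar> \<le> \<alpha> * x + \<alpha> * y" unfolding q1_def q2_def by linarith
    qed simp
    also have "\<dots> = \<bar>c\<bar> * \<bar>x - y\<bar> + \<alpha> * (\<bar>c\<bar> * x + \<bar>c\<bar> * y)" by (simp add: algebra_simps)
    also have "\<dots> \<le> (D / 2 + \<alpha> / 16 * (x\<^sup>2 + y\<^sup>2)) + \<alpha> * ((x\<^sup>2 / 16 + 4 * c\<^sup>2) + (y\<^sup>2 / 16 + 4 * c\<^sup>2))"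
    proof (intro add_mono mult_left_mono \<alpha>)
      \<comment> \<open>The weight 1/16 is half of the available 1/8; the other half pays for the
        difference of the inverse radii.\<close>
      have young: "\<bar>c\<bar> * z \<le> z\<^sup>2 / 16 + 4 * c\<^sup>2" for z
      proof -
        have "0 \<le> (z / 4 - 2 * \<bar>c\<bar>)\<^sup>2" by simp
        then show ?thesis by (simp add: power2_eq_square algebra_simps)
      qed
      show "\<bar>c\<bar> * x \<le> x\<^sup>2 / 16 + 4 * c\<^sup>2" "\<bar>c\<bar> * y \<le> y\<^sup>2 / 16 + 4 * c\<^sup>2" by (rule young)+
      \<comment> \<open>Since |1/r - 1/\<rho>| = d/(r \<rho>), Young's inequality with weight
        \<epsilon> produces D/2 and a remainder c^2 \<epsilon>/(2 r \<rho>), absorbed by the choice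
        of K.\<close>
      define d where "d = \<bar>r - \<rho>\<bar>"
      have "0 \<le> (d - \<bar>c\<bar> * \<epsilon>)\<^sup>2" by simp
      then have "2 * \<epsilon> * (\<bar>c\<bar> * d) \<le> d\<^sup>2 + (c * \<epsilon>)\<^sup>2"
        by (simp add: power2_eq_square algebra_simps abs_mult_self_eq)
      then have "\<bar>c\<bar> * d * (x * y) \<le> (d\<^sup>2 + (c * \<epsilon>)\<^sup>2) / (2 * \<epsilon>) * (x * y)"
        using \<epsilon> xy by (intro mult_right_mono) (auto simp: pos_le_divide_eq mult.commute mult.left_commute)
      also have "\<dots> = D / 2 + c\<^sup>2 * \<epsilon> / 2 * (x * y)"
        unfolding D_def d_def x_def y_def using \<epsilon> r \<rho>
        by (simp add: divide_simps) (simp add: power2_eq_square algebra_simps)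
      also have "c\<^sup>2 * \<epsilon> / 2 * (x * y) \<le> \<alpha> / 8 * ((x\<^sup>2 + y\<^sup>2) / 2)"
      proof (rule mult_mono)
        have "c\<^sup>2 * \<epsilon> \<le> K / 4 * \<epsilon>" using K \<epsilon> by (intro mult_right_mono) auto
        then show "c\<^sup>2 * \<epsilon> / 2 \<le> \<alpha> / 8" unfolding \<alpha>_def by linarith
        have "0 \<le> (x - y)\<^sup>2" by simp
        then show "x * y \<le> (x\<^sup>2 + y\<^sup>2) / 2" by (simp add: power2_eq_square algebra_simps)
      qed (use \<alpha> xy in auto)
      also have "\<bar>c\<bar> * d * (x * y) = \<bar>c\<bar> * \<bar>x - y\<bar>"
      proof -
        have "x - y = (\<rho> - r) * (x * y)" using r \<rho> by (simp add: x_def y_def field_simps)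
        then show ?thesis using xy by (simp add: abs_mult d_def abs_minus_commute)
      qed
      finally show "\<bar>c\<bar> * \<bar>x - y\<bar> \<le> D / 2 + \<alpha> / 16 * (x\<^sup>2 + y\<^sup>2)" by (simp add: field_simps)
    qed
    finally show ?thesis by (simp add: algebra_simps)
  qed
  have gain1: "q1 * (1 + s1\<^sup>2) / r - q * (1 + 1 / (1 + (r * q)\<^sup>2)) / r + \<alpha> * pen_curv r * s1\<^sup>2
      \<le> - (\<alpha> / 8) * x\<^sup>2 + 6 * \<alpha>"
    unfolding sq q1_def x_def by (rule penalty_gain_radial[OF r \<alpha> small])
  have gain2: "q * (1 + 1 / (1 + (\<rho> * q)\<^sup>2)) / \<rho> - q2 * (1 + s2\<^sup>2) / \<rho> + \<alpha> * pen_curv \<rho> * s2\<^sup>2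
      \<le> - (\<alpha> / 8) * y\<^sup>2 + 6 * \<alpha>"
  proof -
    \<comment> \<open>The divergence term is odd in the slope, so the second variable is the first
      one with q replaced by -q.\<close>
    have "- q + \<alpha> * pen_deriv \<rho> = - q2" by (simp add: q2_def)
    with penalty_gain_radial[OF \<rho> \<alpha> small, of "- q"] show ?thesis
      unfolding sq y_def by simp
  qed
  have base: "q * (1 + 1 / (1 + (r * q)\<^sup>2)) / r - q * (1 + 1 / (1 + (\<rho> * q)\<^sup>2)) / \<rho> \<le> - D"
    unfolding D_def using divergence_term_decreasing[OF r \<rho> \<epsilon>, of q] by (simp add: q_def)
  have "8 * K\<^sup>2 * \<epsilon> + 12 * \<alpha> + 8 * c\<^sup>2 * \<alpha> = (8 * K\<^sup>2 + 12 * K + 8 * c\<^sup>2 * K) * \<epsilon>"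
    by (simp add: \<alpha>_def algebra_simps)
  with curvature forcing gain1 gain2 base show ?thesis
    unfolding first_order_def sq[symmetric] distrib_left mult.assoc[symmetric] by linarith
qed

lemma penalty_quadratic_bound:
  fixes r h :: real
  assumes r: "r > 0" and h: "\<bar>h\<bar> \<le> r / 10"
  shows "ln (1 + (r + h)\<^sup>2) - ln (r + h) \<le> ln (1 + r\<^sup>2) - ln r + pen_deriv r * h + pen_curv r / 2 * h\<^sup>2"
proof -
  have pos: "0 < 1 + r\<^sup>2" "0 < 1 + (r + h)\<^sup>2" by (auto intro: add_pos_nonneg)
  have "ln (1 + (r + h)\<^sup>2) - ln (1 + r\<^sup>2) = ln ((1 + (r + h)\<^sup>2) / (1 + r\<^sup>2))"
    using pos by (simp add: ln_div)
  also have "\<dots> \<le> (1 + (r + h)\<^sup>2) / (1 + r\<^sup>2) - 1"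
    using pos by (intro ln_le_minus_one) simp
  also have "\<dots> = 2 * r / (1 + r\<^sup>2) * h + 1 / (1 + r\<^sup>2) * h\<^sup>2"
  proof -
    have "1 + (r + h)\<^sup>2 = (1 + r\<^sup>2) + (2 * r * h + h\<^sup>2)" by (simp add: power2_eq_square algebra_simps)
    then have "(1 + (r + h)\<^sup>2) / (1 + r\<^sup>2) = 1 + (2 * r * h + h\<^sup>2) / (1 + r\<^sup>2)"
      using pos unfolding \<open>1 + (r + h)\<^sup>2 = _\<close> add_divide_distrib[of "1 + r\<^sup>2"] by simp
    then show ?thesis by (simp add: add_divide_distrib)
  qed
  finally have 1: "ln (1 + (r + h)\<^sup>2) - ln (1 + r\<^sup>2) \<le> 2 * r / (1 + r\<^sup>2) * h + 1 / (1 + r\<^sup>2) * h\<^sup>2" .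
  define x where "x = h / r"
  have x: "\<bar>x\<bar> \<le> 1/10" using r h by (simp add: x_def field_simps)
  have "0 \<le> ln (1 + x) - x + 9/16 * x\<^sup>2"
  proof -
    \<comment> \<open>The derivative y (1 + 9 y) / (8 (1 + y)) has the sign of y as long as y >=
      -1/9, which the restriction |h| <= r/10 ensures. With the exact weight 1/2 the bound would
      fail for y < 0.\<close>
    define f where "f y = ln (1 + y) - y + 9/16 * y\<^sup>2" for y :: real
    have df: "(f has_real_derivative (y * (1 + 9 * y) / (8 * (1 + y)))) (at y)" if "-1 < y" for y
      unfolding f_def using that
      by (auto intro!: derivative_eq_intros simp: divide_simps) (simp add: algebra_simps power2_eq_square)
    have "f 0 \<le> f x"
    proof (cases "0 \<le> x")
      case True
      show ?thesis
        by (rule DERIV_nonneg_imp_nondecreasing[OF True]) (use df in \<open>force\<close>)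
    next
      case False
      then have "x \<le> 0" by simp
      then show ?thesis
      proof (rule DERIV_nonpos_imp_nonincreasing)
        fix y assume y: "x \<le> y" "y \<le> 0"
        then have "-1 < y" "0 \<le> 1 + 9 * y" using x by auto
        then have "y * (1 + 9 * y) / (8 * (1 + y)) \<le> 0"
          using y by (intro divide_nonpos_pos mult_nonpos_nonneg) auto
        with df[OF \<open>-1 < y\<close>] show "\<exists>z. (f has_real_derivative z) (at y) \<and> z \<le> 0" by blast
      qed
    qed
    then show ?thesis by (simp add: f_def)
  qed
  moreover have "ln (r + h) = ln r + ln (1 + x)"
  proof -
    have "r + h = r * (1 + x)" using r by (simp add: x_def distrib_left)
    then show ?thesis using r x by (simp add: ln_mult)
  qed
  ultimately have 2: "- ln (r + h) \<le> - ln r - x + 9/16 * x\<^sup>2" by linarith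
  have "- x + 9/16 * x\<^sup>2 = - 1 / r * h + 9 / (16 * r\<^sup>2) * h\<^sup>2"
    by (simp add: x_def power_divide)
  moreover have "pen_deriv r * h + pen_curv r / 2 * h\<^sup>2
     = (2 * r / (1 + r\<^sup>2) * h + 1 / (1 + r\<^sup>2) * h\<^sup>2) + (- 1 / r * h + 9 / (16 * r\<^sup>2) * h\<^sup>2)"
  proof -
    have "pen_curv r / 2 = 1 / (1 + r\<^sup>2) + 9 / (16 * r\<^sup>2)"
    proof -
      define i j where "i = 1 / (1 + r\<^sup>2)" and "j = 9 / (16 * r\<^sup>2)"
      have "2 / (1 + r\<^sup>2) = 2 * i" "9 / (8 * r\<^sup>2) = 2 * j"
        using r by (auto simp: i_def j_def field_simps)
      then have "pen_curv r = 2 * i + 2 * j" by (simp add: pen_curv_def)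
      then have "pen_curv r / 2 = i + j" by simp
      then show ?thesis by (simp add: i_def j_def)
    qed
    then show ?thesis by (simp add: pen_deriv_def distrib_right left_diff_distrib)
  qed
  ultimately show ?thesis using 1 2 by linarith
qed

section \<open>Comparison\<close>

text \<open>The squared positive part is not C^2, but a quadratic upper bound is all that the
  expansion at the maximum requires.\<close>

lemma positive_part_square_le:
  fixes a h :: real
  shows "(max 0 (a + h))\<^sup>2 \<le> (max 0 a)\<^sup>2 + 2 * max 0 a * h + h\<^sup>2"
proof (cases "0 \<le> a")
  case True
  have "(max 0 (a + h))\<^sup>2 \<le> (a + h)\<^sup>2" by (auto simp: max_def)
  then show ?thesis using True by (simp add: power2_sum max_def)
next
  case False
  then have "(max 0 (a + h))\<^sup>2 \<le> h\<^sup>2" by (auto simp: max_def intro!: power_mono)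
  then show ?thesis using False by (simp add: max_def)
qed

text \<open>The B terms vanish up to time t1 and keep the maximum away from a final time T1. The
  term lam * t is the fixed gain, the only one that does not disappear when the two time slopes are
  added.\<close>

definition penalty ::
    "real \<Rightarrow> real \<Rightarrow> real \<Rightarrow> real \<Rightarrow> real \<Rightarrow> real \<Rightarrow> real \<Rightarrow> real \<Rightarrow> real \<Rightarrow> real \<Rightarrow> real" where
  "penalty \<epsilon> \<alpha> N lam B t1 t r s \<rho> = 1 / (2 * \<epsilon>) * (r - \<rho>)\<^sup>2 + N * (t - s)\<^sup>2 + lam * t
     + B * (max 0 (t - t1))\<^sup>2 + B * (max 0 (s - t1))\<^sup>2
     + \<alpha> * (ln (1 + r\<^sup>2) - ln r) + \<alpha> * (ln (1 + \<rho>\<^sup>2) - ln \<rho>)"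

text \<open>Supplies the hypothesis \<open>quad\<close> of \<open>theorem_on_sums\<close>. The mixed
  time term of N (t - s)^2 is absorbed by N (h + k)^2 >= 0.\<close>

lemma penalty_expansion:
  assumes "r > 0" "\<rho> > 0" "\<bar>x\<bar> \<le> r / 10" "\<bar>y\<bar> \<le> \<rho> / 10" "\<alpha> \<ge> 0" "N \<ge> 0" "B \<ge> 0"
  shows "penalty \<epsilon> \<alpha> N lam B t1 (t + h) (r + x) (s + k) (\<rho> + y) \<le> penalty \<epsilon> \<alpha> N lam B t1 t r s \<rho>
     + (2 * N * (t - s) + lam + 2 * B * max 0 (t - t1)) * h + (- (2 * N * (t - s)) + 2 * B * max 0 (s - t1)) * k
     + ((r - \<rho>) / \<epsilon> + \<alpha> * pen_deriv r) * x - ((r - \<rho>) / \<epsilon> - \<alpha> * pen_deriv \<rho>) * y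
     + (2 * N + B) * (h\<^sup>2 + k\<^sup>2)
     + ((1 / \<epsilon> + \<alpha> * pen_curv r) * x\<^sup>2 + 2 * (- 1 / \<epsilon>) * x * y + (1 / \<epsilon> + \<alpha> * pen_curv \<rho>) * y\<^sup>2) / 2"
proof -
  have "\<alpha> * (ln (1 + (r + x)\<^sup>2) - ln (r + x)) \<le> \<alpha> * (ln (1 + r\<^sup>2) - ln r + pen_deriv r * x + pen_curv r / 2 * x\<^sup>2)"
    using assms by (intro mult_left_mono penalty_quadratic_bound) auto
  then have 1: "\<alpha> * (ln (1 + (r + x)\<^sup>2) - ln (r + x))
      \<le> \<alpha> * (ln (1 + r\<^sup>2) - ln r) + \<alpha> * pen_deriv r * x + \<alpha> * pen_curv r * x\<^sup>2 / 2"
    by (simp add: algebra_simps)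
  have "\<alpha> * (ln (1 + (\<rho> + y)\<^sup>2) - ln (\<rho> + y)) \<le> \<alpha> * (ln (1 + \<rho>\<^sup>2) - ln \<rho> + pen_deriv \<rho> * y + pen_curv \<rho> / 2 * y\<^sup>2)"
    using assms by (intro mult_left_mono penalty_quadratic_bound) auto
  then have 2: "\<alpha> * (ln (1 + (\<rho> + y)\<^sup>2) - ln (\<rho> + y))
      \<le> \<alpha> * (ln (1 + \<rho>\<^sup>2) - ln \<rho>) + \<alpha> * pen_deriv \<rho> * y + \<alpha> * pen_curv \<rho> * y\<^sup>2 / 2"
    by (simp add: algebra_simps)
  have max: "B * (max 0 (z + l - t1))\<^sup>2 \<le> B * (max 0 (z - t1))\<^sup>2 + 2 * B * max 0 (z - t1) * l + B * l\<^sup>2" for z l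
  proof -
    have "B * (max 0 ((z - t1) + l))\<^sup>2 \<le> B * ((max 0 (z - t1))\<^sup>2 + 2 * max 0 (z - t1) * l + l\<^sup>2)"
      using assms by (intro mult_left_mono positive_part_square_le) auto
    moreover have "(z - t1) + l = z + l - t1" by simp
    ultimately show ?thesis by (simp add: distrib_left mult.left_commute mult.assoc)
  qed
  have 5: "N * ((t + h) - (s + k))\<^sup>2 \<le> N * (t - s)\<^sup>2 + 2 * N * (t - s) * h - 2 * N * (t - s) * k + 2 * N * (h\<^sup>2 + k\<^sup>2)"
  proof -
    have "0 \<le> N * (h + k)\<^sup>2" using assms by simp
    then show ?thesis by (simp add: power2_eq_square algebra_simps)
  qed
  have 6: "1 / (2 * \<epsilon>) * ((r + x) - (\<rho> + y))\<^sup>2 = 1 / (2 * \<epsilon>) * (r - \<rho>)\<^sup>2 + (r - \<rho>) / \<epsilon> * x - (r - \<rho>) / \<epsilon> * y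
    + (1 / \<epsilon> * x\<^sup>2 + 2 * (- 1 / \<epsilon>) * x * y + 1 / \<epsilon> * y\<^sup>2) / 2"
    by (cases "\<epsilon> = 0") (simp_all add: field_simps power2_eq_square)
  have 7: "((1 / \<epsilon> + \<alpha> * pen_curv r) * x\<^sup>2 + 2 * (- 1 / \<epsilon>) * x * y + (1 / \<epsilon> + \<alpha> * pen_curv \<rho>) * y\<^sup>2) / 2
    = (1 / \<epsilon> * x\<^sup>2 + 2 * (- 1 / \<epsilon>) * x * y + 1 / \<epsilon> * y\<^sup>2) / 2
      + \<alpha> * pen_curv r * x\<^sup>2 / 2 + \<alpha> * pen_curv \<rho> * y\<^sup>2 / 2"
    by (simp only: distrib_right add_divide_distrib)
  have 8: "lam * (t + h) = lam * t + lam * h" "(2 * N + B) * (h\<^sup>2 + k\<^sup>2) = 2 * N * (h\<^sup>2 + k\<^sup>2) + B * h\<^sup>2 + B * k\<^sup>2"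
    by (simp_all add: algebra_simps)
  show ?thesis
    using 1 2 max[of t h] max[of s k] 5
    unfolding penalty_def 6 7 8 unfolding distrib_right left_diff_distrib[of _ _ x] left_diff_distrib[of _ _ y] mult_minus_left
    by linarith
qed

lemma usc_on_affine_shift:
  fixes f :: "real \<times> real \<Rightarrow> real"
  assumes "usc_on S f" and box: "\<And>h x. \<bar>h\<bar> \<le> e \<Longrightarrow> \<bar>x\<bar> \<le> e \<Longrightarrow> (t + h, r + x) \<in> S"
  shows "usc_on ({-e..e} \<times> {-e..e}) (\<lambda>z. f (t + fst z, r + snd z) - a * fst z - q * snd z)"
proof -
  have "usc_on ({-e..e} \<times> {-e..e}) (\<lambda>z. f (t + fst z, r + snd z))"
  proof (rule usc_on_compose[OF assms(1)])
    show "(\<lambda>z. (t + fst z, r + snd z)) ` ({-e..e} \<times> {-e..e}) \<subseteq> S"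
      by (auto intro!: box)
  qed (intro continuous_intros)
  then show ?thesis by (intro usc_on_diff_continuous continuous_intros)
qed

text \<open>In a + b the doubling slopes in time cancel, leaving at least lam. Making both equations
  strict costs lam/2 and the doubling estimate allows only lam/4, so lam/2 <= lam/4.\<close>

lemma no_interior_maximum:
  fixes c t r s \<rho> \<epsilon> :: real
  assumes sub: "viscosity_subsolution c T u0 u" and super: "viscosity_supersolution c T u0 v"
    and pt: "0 < t" "ereal t < T" "0 < r" "0 < s" "ereal s < T" "0 < \<rho>"
    and d: "0 < d"
    and box1: "\<And>h x. \<bar>h\<bar> \<le> d \<Longrightarrow> \<bar>x\<bar> \<le> d \<Longrightarrow> (t + h, r + x) \<in> spacetime T"
    and box2: "\<And>k y. \<bar>k\<bar> \<le> d \<Longrightarrow> \<bar>y\<bar> \<le> d \<Longrightarrow> (s + k, \<rho> + y) \<in> spacetime T"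
    and \<epsilon>: "0 < \<epsilon>" and small: "\<alpha> \<le> 1/2" and N: "0 \<le> N" and B: "0 \<le> B" and lam: "0 < lam"
    and K: "K = 4 * c\<^sup>2 + 1" and \<alpha>: "\<alpha> = K * \<epsilon>"
    and eps_small: "(8 * K\<^sup>2 + 12 * K + 8 * c\<^sup>2 * K) * \<epsilon> \<le> lam / 4"
    and max: "\<And>h x k y. \<bar>h\<bar> \<le> d \<Longrightarrow> \<bar>x\<bar> \<le> d \<Longrightarrow> \<bar>k\<bar> \<le> d \<Longrightarrow> \<bar>y\<bar> \<le> d \<Longrightarrow>
       u (t + h, r + x) - v (s + k, \<rho> + y) - penalty \<epsilon> \<alpha> N lam B t1 (t + h) (r + x) (s + k) (\<rho> + y)
       \<le> u (t, r) - v (s, \<rho>) - penalty \<epsilon> \<alpha> N lam B t1 t r s \<rho>"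
  shows False
proof -
  define q1 q2 where "q1 = (r - \<rho>) / \<epsilon> + \<alpha> * pen_deriv r" and "q2 = (r - \<rho>) / \<epsilon> - \<alpha> * pen_deriv \<rho>"
  define s1 s2 where "s1 = 1 / sqrt (1 + (r * q1)\<^sup>2)" and "s2 = 1 / sqrt (1 + (\<rho> * q2)\<^sup>2)"
  have sq: "s1\<^sup>2 = 1 / (1 + (r * q1)\<^sup>2)" "s2\<^sup>2 = 1 / (1 + (\<rho> * q2)\<^sup>2)"
    unfolding s1_def s2_def by (auto simp: power_divide add_nonneg_nonneg)
  have "0 < 1 + (r * q1)\<^sup>2" "0 < 1 + (\<rho> * q2)\<^sup>2" by (auto intro: add_pos_nonneg)
  then have sq_pos: "s1\<^sup>2 > 0" "s2\<^sup>2 > 0" unfolding sq by auto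
  define a b where "a = 2 * N * (t - s) + lam + 2 * B * max 0 (t - t1)"
    and "b = - (2 * N * (t - s)) + 2 * B * max 0 (s - t1)"
  have ab: "lam \<le> a + b" using B by (simp add: a_def b_def)
  \<comment> \<open>These are the curvatures that solve the two equations with time slopes a and b
    lowered by lam/4; the slack supplies the strict inequality in
    \<open>touching_bound_near\<close>.\<close>
  define b1 b2 where "b1 = (a - first_order c r q1 - lam / 4) / s1\<^sup>2"
    and "b2 = (b + first_order c \<rho> q2 - lam / 4) / s2\<^sup>2"
  have b12: "s1\<^sup>2 * b1 = a - first_order c r q1 - lam / 4" "s2\<^sup>2 * b2 = b + first_order c \<rho> q2 - lam / 4"
    using sq_pos by (auto simp: b1_def b2_def)
  have F: "Fbar c r q X = r * (first_order c r q + 1 / (1 + (r * q)\<^sup>2) * X)" if "r > 0" for c r q X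
    using Fbar_first_order[OF that] by simp
  have "Fbar c r q1 b1 = r * (a - lam / 4)"
    unfolding F[OF pt(3)] sq(1)[symmetric] b12(1) by simp
  also have "\<dots> < r * a" using pt lam by simp
  finally have "\<exists>\<delta>>0. \<forall>h x a' p X. \<bar>h\<bar> < \<delta> \<longrightarrow> \<bar>x\<bar> < \<delta> \<longrightarrow> \<bar>a'\<bar> < \<delta> \<longrightarrow> \<bar>p\<bar> < \<delta> \<longrightarrow>
      touches_above (\<lambda>z. u (t + fst z, r + snd z) - a * fst z - q1 * snd z) h x a' p X \<longrightarrow> b1 \<le> X"
    by (intro touching_bound_near[OF _ pt(1-3)]) (rule subsolution_touches_above[OF sub])
  then obtain \<delta>1 where \<delta>1: "\<delta>1 > 0" "\<And>h x a' p X. \<bar>h\<bar> < \<delta>1 \<Longrightarrow> \<bar>x\<bar> < \<delta>1 \<Longrightarrow> \<bar>a'\<bar> < \<delta>1 \<Longrightarrow> \<bar>p\<bar> < \<delta>1 \<Longrightarrow>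
      touches_above (\<lambda>z. u (t + fst z, r + snd z) - a * fst z - q1 * snd z) h x a' p X \<Longrightarrow> b1 \<le> X"
    by blast
  have "first_order (- c) \<rho> (- q2) = - first_order c \<rho> q2"
    by (simp add: first_order_def)
  then have "Fbar (- c) \<rho> (- q2) b2 = \<rho> * (b - lam / 4)"
    unfolding F[OF pt(6)] using b12(2) sq(2) by simp
  also have "\<dots> < \<rho> * b" using pt lam by simp
  finally have "\<exists>\<delta>>0. \<forall>h x a' p X. \<bar>h\<bar> < \<delta> \<longrightarrow> \<bar>x\<bar> < \<delta> \<longrightarrow> \<bar>a'\<bar> < \<delta> \<longrightarrow> \<bar>p\<bar> < \<delta> \<longrightarrow>
      touches_above (\<lambda>z. - v (s + fst z, \<rho> + snd z) - b * fst z - (- q2) * snd z) h x a' p X \<longrightarrow> b2 \<le> X"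
    by (intro touching_bound_near[where u = "\<lambda>z. - v z", OF _ pt(4-6)])
       (rule supersolution_touches_above[OF super])
  then obtain \<delta>2 where \<delta>2: "\<delta>2 > 0" "\<And>h x a' p X. \<bar>h\<bar> < \<delta>2 \<Longrightarrow> \<bar>x\<bar> < \<delta>2 \<Longrightarrow> \<bar>a'\<bar> < \<delta>2 \<Longrightarrow> \<bar>p\<bar> < \<delta>2 \<Longrightarrow>
      touches_above (\<lambda>z. - v (s + fst z, \<rho> + snd z) - b * fst z - (- q2) * snd z) h x a' p X \<Longrightarrow> b2 \<le> X"
    by blast
  define w1 w2 where "w1 z = u (t + fst z, r + snd z) - a * fst z - q1 * snd z"
    and "w2 z = - v (s + fst z, \<rho> + snd z) - b * fst z - (- q2) * snd z" for z
  define e where "e = min d (min (r / 10) (\<rho> / 10))"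
  have e: "e > 0" "e \<le> d" "e \<le> r / 10" "e \<le> \<rho> / 10" using d pt by (auto simp: e_def)
  have "usc_on (spacetime T) u" using sub by (simp add: viscosity_subsolution_def)
  then have usc1: "usc_on ({-e..e} \<times> {-e..e}) w1"
    unfolding w1_def by (rule usc_on_affine_shift) (use e in \<open>auto intro!: box1\<close>)
  have "lsc_on (spacetime T) v" using super by (simp add: viscosity_supersolution_def)
  then have "usc_on (spacetime T) (\<lambda>z. - v z)" by (rule lsc_on_uminus)
  then have usc2: "usc_on ({-e..e} \<times> {-e..e}) w2"
    unfolding w2_def by (rule usc_on_affine_shift) (use e in \<open>auto intro!: box2\<close>)
  \<comment> \<open>The direction (s1, s2) turns the b_i into the diffusion terms of the equations,
    and the 1/\<epsilon> part of the form into a perfect square.\<close>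
  have sums: "s1\<^sup>2 * b1 + s2\<^sup>2 * b2 \<le> (1 / \<epsilon> + \<alpha> * pen_curv r) * s1\<^sup>2 + 2 * (- 1 / \<epsilon>) * s1 * s2
      + (1 / \<epsilon> + \<alpha> * pen_curv \<rho>) * s2\<^sup>2"
  proof (rule theorem_on_sums[OF e(1) _ _ usc1 usc2, where m = "2 * N + B" and \<delta> = "min \<delta>1 \<delta>2"])
    show "0 \<le> 2 * N + B" using N B by simp
    show "0 < min \<delta>1 \<delta>2" using \<delta>1 \<delta>2 by simp
    fix h x a' p X
    assume "\<bar>h\<bar> < min \<delta>1 \<delta>2" "\<bar>x\<bar> < min \<delta>1 \<delta>2" "\<bar>a'\<bar> < min \<delta>1 \<delta>2" "\<bar>p\<bar> < min \<delta>1 \<delta>2"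
    then show "b1 \<le> X" if "touches_above w1 h x a' p X"
      by (intro \<delta>1(2)[OF _ _ _ _ that[unfolded w1_def]]) auto
  next
    fix h x a' p X
    assume "\<bar>h\<bar> < min \<delta>1 \<delta>2" "\<bar>x\<bar> < min \<delta>1 \<delta>2" "\<bar>a'\<bar> < min \<delta>1 \<delta>2" "\<bar>p\<bar> < min \<delta>1 \<delta>2"
    then show "b2 \<le> X" if "touches_above w2 h x a' p X"
      by (intro \<delta>2(2)[OF _ _ _ _ that[unfolded w2_def]]) auto
  next
    fix h x k y assume *: "\<bar>h\<bar> \<le> e" "\<bar>x\<bar> \<le> e" "\<bar>k\<bar> \<le> e" "\<bar>y\<bar> \<le> e"
    have "\<alpha> \<ge> 0" using K \<alpha> \<epsilon> by simp
    then have "penalty \<epsilon> \<alpha> N lam B t1 (t + h) (r + x) (s + k) (\<rho> + y) \<le> penalty \<epsilon> \<alpha> N lam B t1 t r s \<rho>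
     + a * h + b * k + q1 * x - q2 * y + (2 * N + B) * (h\<^sup>2 + k\<^sup>2)
     + ((1 / \<epsilon> + \<alpha> * pen_curv r) * x\<^sup>2 + 2 * (- 1 / \<epsilon>) * x * y + (1 / \<epsilon> + \<alpha> * pen_curv \<rho>) * y\<^sup>2) / 2"
      unfolding a_def b_def q1_def q2_def
      by (intro penalty_expansion) (use * e pt N B in auto)
    moreover have "u (t + h, r + x) - v (s + k, \<rho> + y) - penalty \<epsilon> \<alpha> N lam B t1 (t + h) (r + x) (s + k) (\<rho> + y)
       \<le> u (t, r) - v (s, \<rho>) - penalty \<epsilon> \<alpha> N lam B t1 t r s \<rho>"
      using * e by (intro max) auto
    ultimately show "w1 (h, x) + w2 (k, y) \<le> w1 (0, 0) + w2 (0, 0) + (2 * N + B) * (h\<^sup>2 + k\<^sup>2)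
     + ((1 / \<epsilon> + \<alpha> * pen_curv r) * x\<^sup>2 + 2 * (- 1 / \<epsilon>) * x * y + (1 / \<epsilon> + \<alpha> * pen_curv \<rho>) * y\<^sup>2) / 2"
      by (simp add: w1_def w2_def)
  qed
  have "(1 / \<epsilon> + \<alpha> * pen_curv r) * s1\<^sup>2 + 2 * (- 1 / \<epsilon>) * s1 * s2 + (1 / \<epsilon> + \<alpha> * pen_curv \<rho>) * s2\<^sup>2
      = (s1 - s2)\<^sup>2 / \<epsilon> + \<alpha> * (pen_curv r * s1\<^sup>2 + pen_curv \<rho> * s2\<^sup>2)"
    using \<epsilon> by (simp add: field_simps power2_eq_square)
  with sums have "a + b - lam / 2 \<le> first_order c r q1 - first_order c \<rho> q2 + (s1 - s2)\<^sup>2 / \<epsilon>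
      + \<alpha> * (pen_curv r * s1\<^sup>2 + pen_curv \<rho> * s2\<^sup>2)"
    unfolding b12 by linarith
  also have "\<dots> \<le> (8 * K\<^sup>2 + 12 * K + 8 * c\<^sup>2 * K) * \<epsilon>"
    using doubling_estimate[OF pt(3,6) \<epsilon>, of c] small
    unfolding s1_def s2_def q1_def q2_def \<alpha> K by simp
  finally show False using ab eps_small lam by linarith
qed

section \<open>Bounds behind the choice of parameters\<close>

lemma mult_le_square_bound:
  fixes L d \<epsilon> :: real
  assumes "\<epsilon> > 0"
  shows "L * d - 1 / (2 * \<epsilon>) * d\<^sup>2 \<le> L\<^sup>2 * \<epsilon> / 2"
proof -
  have "L\<^sup>2 * \<epsilon> / 2 - (L * d - 1 / (2 * \<epsilon>) * d\<^sup>2) = 1 / (2 * \<epsilon>) * (d - L * \<epsilon>)\<^sup>2"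
    using assms by (simp add: field_simps power2_eq_square)
  moreover have "0 \<le> 1 / (2 * \<epsilon>) * (d - L * \<epsilon>)\<^sup>2" using assms by simp
  ultimately show ?thesis by linarith
qed

lemma radial_penalty_nonneg:
  fixes r :: real
  assumes "r > 0"
  shows "0 \<le> ln (1 + r\<^sup>2) - ln r"
proof -
  have "0 \<le> (r - 1)\<^sup>2" by simp
  then have "r \<le> 1 + r\<^sup>2" using assms by (simp add: power2_eq_square algebra_simps)
  then show ?thesis using assms by simp
qed

text \<open>The penalty dominates |ln r|, so a bound on it confines r to an interval
  [1/R, R].\<close>

lemma radial_penalty_ge:
  fixes r :: real
  assumes "r > 0"
  shows "ln r \<le> ln (1 + r\<^sup>2) - ln r" "- ln r \<le> ln (1 + r\<^sup>2) - ln r"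
proof -
  have "ln (r\<^sup>2) \<le> ln (1 + r\<^sup>2)" using assms by (subst ln_le_cancel_iff) (auto intro: add_pos_nonneg)
  then show "ln r \<le> ln (1 + r\<^sup>2) - ln r" using assms by (simp add: ln_realpow)
  show "- ln r \<le> ln (1 + r\<^sup>2) - ln r" by simp
qed

lemma small_parameter:
  fixes K Z l m \<psi> L :: real
  assumes "K > 0" "Z > 0" "l > 0" "m > 0" "\<psi> \<ge> 0"
  obtains \<epsilon> where "\<epsilon> > 0" "K * \<epsilon> \<le> 1/2" "Z * \<epsilon> \<le> l" "2 * (K * \<epsilon>) * \<psi> \<le> m" "L\<^sup>2 * \<epsilon> / 2 \<le> m"
proof -
  define S where "S = max (max (2 * K) (Z / l)) (max (2 * K * \<psi> / m) (L\<^sup>2 / (2 * m)))"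
  have S: "2 * K \<le> S" "Z / l \<le> S" "2 * K * \<psi> / m \<le> S" "L\<^sup>2 / (2 * m) \<le> S" "S > 0"
    using assms by (auto simp: S_def)
  then have "Z \<le> l * S" "2 * K * \<psi> \<le> m * S" "L\<^sup>2 / 2 \<le> m * S"
    using assms by (auto simp: field_simps)
  then show thesis using S assms
    by (intro that[of "1 / S"]) (auto simp: field_simps)
qed

theorem theorem1p2:
  fixes c :: real and T :: ereal and u0 :: "real \<Rightarrow> real" and u v :: "real \<times> real \<Rightarrow> real"
  assumes "0 < T"
    and "\<exists>L. L-lipschitz_on {0<..} u0"
    and "viscosity_subsolution c T u0 u"
    and "viscosity_supersolution c T u0 v"
    and "\<exists>C1>0. \<forall>t r. 0 \<le> t \<longrightarrow> ereal t < T \<longrightarrow> 0 < r \<longrightarrow>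
           u (t, r) - u0 r \<le> C1 \<and> v (t, r) - u0 r \<ge> - C1"
    and "\<forall>r>0. u (0, r) \<le> u0 r \<and> u0 r \<le> v (0, r)"
  shows "\<forall>t r. 0 \<le> t \<longrightarrow> ereal t < T \<longrightarrow> 0 < r \<longrightarrow> u (t, r) \<le> v (t, r)"
proof (intro allI impI)
  fix t1 r1 :: real assume t1: "0 \<le> t1" "ereal t1 < T" and r1: "0 < r1"
  show "u (t1, r1) \<le> v (t1, r1)"
  proof (rule ccontr)
    assume neg: "\<not> ?thesis"
    define m where "m = u (t1, r1) - v (t1, r1)"
    have m: "m > 0" using neg by (simp add: m_def)
    obtain L where L: "L-lipschitz_on {0<..} u0" using assms(2) by blast
    obtain C1 where C1: "C1 > 0" "\<And>t r. 0 \<le> t \<Longrightarrow> ereal t < T \<Longrightarrow> 0 < r \<Longrightarrow>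
           u (t, r) - u0 r \<le> C1 \<and> v (t, r) - u0 r \<ge> - C1" using assms(5) by blast
    have lip: "u0 r - u0 \<rho> \<le> L * \<bar>r - \<rho>\<bar>" if "0 < r" "0 < \<rho>" for r \<rho>
      using lipschitz_onD[OF L, of r \<rho>] that by (simp add: dist_real_def)
    \<comment> \<open>T may be infinite and nothing is known near it, so time is cut off strictly
      before T.\<close>
    obtain T1 where T1: "t1 < T1" "ereal T1 < T"
      using ereal_dense2[OF t1(2)] by auto
    define lam where "lam = m / (8 * (t1 + 1))"
    have lam: "lam > 0" "lam * t1 \<le> m / 8"
      using m t1 by (auto simp: lam_def field_simps)
    define K where "K = 4 * c\<^sup>2 + 1"
    have K: "K > 0" by (simp add: K_def add_nonneg_pos)
    define \<psi> where "\<psi> r = ln (1 + r\<^sup>2) - ln r" for r :: real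
    have \<psi>: "0 \<le> \<psi> r" "ln r \<le> \<psi> r" "- ln r \<le> \<psi> r" if "r > 0" for r
      unfolding \<psi>_def by (rule radial_penalty_nonneg[OF that] radial_penalty_ge[OF that])+
    have "0 < 8 * K\<^sup>2 + 12 * K + 8 * c\<^sup>2 * K" using K by (intro add_pos_nonneg add_nonneg_pos) auto
    moreover have "lam / 4 > 0" "m / 8 > 0" using lam m by auto
    ultimately obtain \<epsilon> where \<epsilon>: "\<epsilon> > 0" "K * \<epsilon> \<le> 1/2"
      "(8 * K\<^sup>2 + 12 * K + 8 * c\<^sup>2 * K) * \<epsilon> \<le> lam / 4"
      "2 * (K * \<epsilon>) * \<psi> r1 \<le> m / 8" "L\<^sup>2 * \<epsilon> / 2 \<le> m / 8"
      using small_parameter[OF K _ _ _ \<psi>(1)[OF r1]] by metis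
    define \<alpha> where "\<alpha> = K * \<epsilon>"
    have \<alpha>: "\<alpha> > 0" using K \<epsilon> by (simp add: \<alpha>_def)
    \<comment> \<open>Z bounds u(t,r) - v(s,\<rho>) - (r - \<rho>)^2/(2 \<epsilon>), because u - v
      <= 2 C1 + L |r - \<rho>|. B and R are set so that the penalties at time T1 and at the radii
      1/R and R already reach Z.\<close>
    define Z where "Z = 2 * C1 + L\<^sup>2 * \<epsilon> / 2"
    have Z: "Z > 0" using C1 \<epsilon> by (simp add: Z_def add_pos_nonneg)
    define B where "B = Z / (T1 - t1)\<^sup>2"
    have B: "B \<ge> 0" "B * (T1 - t1)\<^sup>2 = Z" using Z T1 by (auto simp: B_def)
    define R where "R = exp (Z / \<alpha>)"
    have R: "R > 0" "\<alpha> * ln R = Z" using \<alpha> by (auto simp: R_def)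
    have dR: "1 / R < r \<and> r < R" if "r > 0" "\<alpha> * \<psi> r < Z" for r
    proof -
      have "\<alpha> * \<psi> r < \<alpha> * ln R" using that R by simp
      then have "\<psi> r < ln R" using \<alpha> by simp
      then have "ln r < ln R" "- ln r < ln R" using \<psi>[OF that(1)] by auto
      moreover from this(2) have "ln (1 / R) < ln r" using R by (simp add: ln_div)
      ultimately show ?thesis using that(1) R by simp
    qed
    define P where "P N t r s \<rho> = penalty \<epsilon> \<alpha> N lam B t1 t r s \<rho>" for N t r s \<rho>
    define K4 where "K4 = ({0..T1} \<times> {1 / R..R}) \<times> ({0..T1} \<times> {1 / R..R})"
    have K4: "compact K4" unfolding K4_def by (intro compact_Times compact_Icc)
    have mem: "(t, r) \<in> spacetime T" if "t \<in> {0..T1}" "r \<in> {1 / R..R}" for t r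
    proof -
      have "ereal t < T" using that T1 by (meson atLeastAtMost_iff ereal_less_eq(3) le_less_trans)
      moreover have "0 < r" using that R by (meson atLeastAtMost_iff less_le_trans zero_less_divide_1_iff)
      ultimately show ?thesis using that by (simp add: spacetime_def)
    qed
    define F where "F N z = u (fst z) - v (snd z) - P N (fst (fst z)) (snd (fst z)) (fst (snd z)) (snd (snd z))"
      for N z
    have PN: "P N t r s \<rho> = P 0 t r s \<rho> + N * (t - s)\<^sup>2" for N t r s \<rho>
      by (simp add: P_def penalty_def)
    have FN: "F N z = F 0 z - N * (fst (fst z) - fst (snd z))\<^sup>2" for N z
      by (simp add: F_def PN[of N])
    have uscF: "usc_on K4 (F N)" for N
    proof -
      have "usc_on (spacetime T) u" using assms(3) by (simp add: viscosity_subsolution_def)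
      then have 1: "usc_on K4 (\<lambda>z. u (fst z))"
        by (rule usc_on_compose) (auto simp: K4_def intro!: continuous_intros mem)
      have "lsc_on (spacetime T) v" using assms(4) by (simp add: viscosity_supersolution_def)
      from lsc_on_uminus[OF this] have 2: "usc_on K4 (\<lambda>z. - v (snd z))"
        by (rule usc_on_compose) (auto simp: K4_def intro!: continuous_intros mem)
      have pos: "0 < snd (fst z)" "0 < snd (snd z)" if "z \<in> K4" for z
      proof -
        have "1 / R \<le> snd (fst z)" "1 / R \<le> snd (snd z)" using that by (auto simp: K4_def)
        moreover have "0 < 1 / R" using R by simp
        ultimately show "0 < snd (fst z)" "0 < snd (snd z)" by linarith+
      qed
      have pos': "1 + (x::real)\<^sup>2 \<noteq> 0" for x
        using zero_le_power2[of x] by linarith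
      have "continuous_on K4 (\<lambda>z. P N (fst (fst z)) (snd (fst z)) (fst (snd z)) (snd (snd z)))"
        unfolding P_def penalty_def
        by (intro continuous_intros ballI pos') (use pos in \<open>force+\<close>)
      from usc_on_diff_continuous[OF usc_on_add[OF 1 2] this] show ?thesis
        by (simp add: F_def[abs_def])
    qed
    have upper: "F N ((t, r), (s, \<rho>)) \<le> Z - (P N t r s \<rho> - 1 / (2 * \<epsilon>) * (r - \<rho>)\<^sup>2)"
      if "((t, r), (s, \<rho>)) \<in> K4" for N t r s \<rho>
    proof -
      have st: "(t, r) \<in> spacetime T" "(s, \<rho>) \<in> spacetime T" using that mem by (auto simp: K4_def)
      then have "u (t, r) - u0 r \<le> C1" "- C1 \<le> v (s, \<rho>) - u0 \<rho>" "u0 r - u0 \<rho> \<le> L * \<bar>r - \<rho>\<bar>"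
        using C1(2) lip by (auto simp: spacetime_def)
      then have "u (t, r) - v (s, \<rho>) \<le> 2 * C1 + L * \<bar>r - \<rho>\<bar>" by linarith
      then show ?thesis
        using mult_le_square_bound[OF \<epsilon>(1), of L "\<bar>r - \<rho>\<bar>"] by (simp add: F_def Z_def)
    qed
    have penalty_parts: "P N t r s \<rho> - 1 / (2 * \<epsilon>) * (r - \<rho>)\<^sup>2 = N * (t - s)\<^sup>2 + lam * t
        + B * (max 0 (t - t1))\<^sup>2 + B * (max 0 (s - t1))\<^sup>2 + \<alpha> * \<psi> r + \<alpha> * \<psi> \<rho>" for N t r s \<rho>
      by (simp add: P_def penalty_def \<psi>_def)
    \<comment> \<open>The doubling parameter \<open>N\<close> in time is chosen last: at fixed \<open>\<epsilon>\<close> the points range over a compact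
      set, so only the initial data at \<open>t = s = 0\<close> matter, and no uniform estimate for small times is needed.\<close>
    define face where "face = {z \<in> K4. fst (fst z) = 0 \<or> fst (snd z) = 0}"
    have "closed {z :: (real \<times> real) \<times> (real \<times> real). fst (fst z) = 0 \<or> fst (snd z) = 0}"
      by (intro closed_Collect_disj closed_Collect_eq continuous_intros)
    from compact_Int_closed[OF K4 this] have face: "compact face"
      unfolding face_def Int_def by simp
    \<comment> \<open>The threshold m/4 separates the m/8 possible on the face at equal times from
      the m/2 attained at the contradiction point.\<close>
    have "\<exists>N\<ge>0. \<forall>z\<in>face. F 0 z - N * (fst (fst z) - fst (snd z))\<^sup>2 < m / 4"
    proof (rule usc_on_penalization[OF face])
      show "usc_on face (F 0)" by (rule usc_on_subset[OF uscF]) (auto simp: face_def)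
      show "continuous_on face (\<lambda>z. (fst (fst z) - fst (snd z))\<^sup>2)" by (intro continuous_intros)
      show "0 \<le> (fst (fst z) - fst (snd z))\<^sup>2" for z :: "(real \<times> real) \<times> (real \<times> real)" by simp
      \<comment> \<open>On the face equal times are both 0, where u and v are ordered by the initial
        data up to L |r - \<rho>|.\<close>
      fix z assume z: "z \<in> face" "(fst (fst z) - fst (snd z))\<^sup>2 = 0"
      then have "fst (fst z) = 0" "fst (snd z) = 0" by (auto simp: face_def)
      then obtain r \<rho> where zr: "z = ((0, r), (0, \<rho>))" by (metis prod.collapse)
      have pos: "0 < r" "0 < \<rho>" using z mem unfolding zr by (auto simp: face_def K4_def spacetime_def)
      have "u (0, r) \<le> u0 r" "u0 \<rho> \<le> v (0, \<rho>)" using assms(6) pos by blast+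
      then have "u (0, r) - v (0, \<rho>) \<le> L * \<bar>r - \<rho>\<bar>" using lip[OF pos] by linarith
      moreover have "0 \<le> \<alpha> * \<psi> r" "0 \<le> \<alpha> * \<psi> \<rho>" using \<psi>(1) pos \<alpha> by auto
      moreover have "0 \<le> B * (max 0 (0 - t1))\<^sup>2" using B by simp
      ultimately have "u (0, r) - v (0, \<rho>) - P 0 0 r 0 \<rho> \<le> L * \<bar>r - \<rho>\<bar> - 1 / (2 * \<epsilon>) * \<bar>r - \<rho>\<bar>\<^sup>2"
        using penalty_parts[of 0 0 r 0 \<rho>] unfolding power2_abs by linarith
      then show "F 0 z < m / 4"
        using mult_le_square_bound[OF \<epsilon>(1), of L "\<bar>r - \<rho>\<bar>"] \<epsilon>(5) m unfolding zr F_def fst_conv snd_conv by linarith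
    qed
    then obtain N where N: "N \<ge> 0" "\<forall>z\<in>face. F 0 z - N * (fst (fst z) - fst (snd z))\<^sup>2 < m / 4"
      by blast
    have NF: "F N z < m / 4" if "z \<in> face" for z
      unfolding FN[of N] using N(2) that by blast
    have "m \<le> 2 * C1" using C1(2)[OF t1 r1] by (simp add: m_def)
    moreover have "0 \<le> \<alpha> * \<psi> r1" using \<alpha> \<psi>(1)[OF r1] by simp
    moreover have "2 * (\<alpha> * \<psi> r1) \<le> m / 8" using \<epsilon>(4) by (simp add: \<alpha>_def mult.assoc)
    moreover have "0 \<le> L\<^sup>2 * \<epsilon> / 2" using \<epsilon>(1) by simp
    ultimately have "\<alpha> * \<psi> r1 < Z" using m unfolding Z_def by linarith
    then have z1: "((t1, r1), (t1, r1)) \<in> K4"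
      using dR[OF r1] t1 T1 by (simp add: K4_def)
    \<comment> \<open>On the diagonal at time t1 only lam * t1 and the two radial penalties remain,
      at most m/8 each in total.\<close>
    have F1: "m / 2 \<le> F N ((t1, r1), (t1, r1))"
      using penalty_parts[of N t1 r1 t1 r1] lam(2) \<open>2 * (\<alpha> * \<psi> r1) \<le> m / 8\<close> m
      unfolding F_def by (simp add: m_def[symmetric])
    obtain z where z: "z \<in> K4" "\<And>z'. z' \<in> K4 \<Longrightarrow> F N z' \<le> F N z"
      using usc_on_attains_max[OF K4 _ uscF] z1 by blast
    obtain t r s \<rho> where ze: "z = ((t, r), (s, \<rho>))" by (metis surj_pair)
    have Fz: "m / 2 \<le> F N z" using F1 z(2)[OF z1] by linarith
    have "z \<notin> face"
    proof
      assume "z \<in> face"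
      from NF[OF this] Fz m show False by linarith
    qed
    then have ts: "0 < t" "0 < s" "t \<le> T1" "s \<le> T1" and rr: "0 < r" "0 < \<rho>"
      using z(1) mem unfolding ze by (auto simp: face_def K4_def spacetime_def)
    \<comment> \<open>The maximum is positive, so every single penalty stays strictly below Z; this
      puts the maximum point in the interior of \<open>K4\<close>.\<close>
    have "0 \<le> N * (t - s)\<^sup>2" "0 \<le> lam * t" "0 \<le> B * (max 0 (t - t1))\<^sup>2" "0 \<le> B * (max 0 (s - t1))\<^sup>2"
      "0 \<le> \<alpha> * \<psi> r" "0 \<le> \<alpha> * \<psi> \<rho>"
      using N lam B \<alpha> \<psi>(1) ts rr by auto
    then have parts: "\<alpha> * \<psi> r < Z" "\<alpha> * \<psi> \<rho> < Z" "B * (max 0 (t - t1))\<^sup>2 < Z" "B * (max 0 (s - t1))\<^sup>2 < Z"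
      using upper[of t r s \<rho> N] z(1) Fz m unfolding ze penalty_parts by linarith+
    have "t \<noteq> T1" "s \<noteq> T1" using parts(3,4) B(2) T1 by (auto simp: max_def)
    then have ts': "t < T1" "s < T1" using ts by auto
    have rr': "1 / R < r" "r < R" "1 / R < \<rho>" "\<rho> < R"
      using dR[OF rr(1) parts(1)] dR[OF rr(2) parts(2)] by auto
    define d where "d = min (min (min t (T1 - t)) (min s (T1 - s)))
      (min (min (r - 1 / R) (R - r)) (min (\<rho> - 1 / R) (R - \<rho>)))"
    have d: "0 < d" "d \<le> t" "d \<le> T1 - t" "d \<le> s" "d \<le> T1 - s" "d \<le> r - 1 / R" "d \<le> R - r"
      "d \<le> \<rho> - 1 / R" "d \<le> R - \<rho>"
      using ts ts' rr' by (auto simp: d_def)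
    have box: "t + h \<in> {0..T1}" "r + x \<in> {1 / R..R}" "s + h \<in> {0..T1}" "\<rho> + x \<in> {1 / R..R}"
      if "\<bar>h\<bar> \<le> d" "\<bar>x\<bar> \<le> d" for h x
      using that d by auto
    have tT: "ereal t < T" "ereal s < T"
      using ts' T1(2) by (meson ereal_less_eq(3) le_less_trans less_imp_le)+
    show False
    proof (rule no_interior_maximum[OF assms(3,4) ts(1) tT(1) rr(1) ts(2) tT(2) rr(2) d(1) _ _ \<epsilon>(1)])
      show "\<alpha> \<le> 1/2" using \<epsilon>(2) by (simp add: \<alpha>_def)
      show "0 \<le> N" "0 \<le> B" "0 < lam" "K = 4 * c\<^sup>2 + 1" "\<alpha> = K * \<epsilon>"
        using N B lam by (auto simp: K_def \<alpha>_def)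
      show "(8 * K\<^sup>2 + 12 * K + 8 * c\<^sup>2 * K) * \<epsilon> \<le> lam / 4" by fact
      fix h x assume hx: "\<bar>h\<bar> \<le> d" "\<bar>x\<bar> \<le> d"
      show "(t + h, r + x) \<in> spacetime T" "(s + h, \<rho> + x) \<in> spacetime T"
        using box[OF hx] by (auto intro!: mem)
      fix k y assume ky: "\<bar>k\<bar> \<le> d" "\<bar>y\<bar> \<le> d"
      have "((t + h, r + x), (s + k, \<rho> + y)) \<in> K4"
        using box[OF hx] box[OF ky] by (simp add: K4_def)
      from z(2)[OF this] show "u (t + h, r + x) - v (s + k, \<rho> + y)
          - penalty \<epsilon> \<alpha> N lam B t1 (t + h) (r + x) (s + k) (\<rho> + y)
          \<le> u (t, r) - v (s, \<rho>) - penalty \<epsilon> \<alpha> N lam B t1 t r s \<rho>"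
        by (simp add: F_def P_def ze)
    qed
  qed
qed

end
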